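(* Let $A_1,A_2,C\in\mathbf{S}_+(n)$, and without loss of generality suppose that $A_1$ is the matrix in the geodesic $\varphi_{A_1\to A_2}$ that minimizes the distance $d\big(\varphi_{A_1\to A_2}(t),C\big)$. Then the difference between the solutions of the reverse I-projection problem and the natural projection problem, as a function of $\epsilon=d\big(\varphi_{A_1\to A_2}(t),C\big)$, is $\hat\Delta t(\epsilon)$, defined implicitly by $$\operatorname{tr}\Big(\big(U^\top V\Sigma^{\epsilon}V^\top U\,\Lambda^{\hat\Delta t(\epsilon)}-\mathrm{Id}\big)\log_m(\Lambda)\Big)=0,$$ where $V\Sigma V^\top=A_1^{-1/2}CA_1^{-1/2}$ and $U\Lambda U^\top=A_1^{-1/2}A_2A_1^{-1/2}$ are orthogonal eigendecompositions. Similarly, the difference between the solutions of the I-projection problem and the natural projection problem, as a function of $\epsilon$, is $\check\Delta t(\epsilon)$, defined implicitly by $$\operatorname{tr}\Big(\big(\Lambda^{-\check\Delta t(\epsilon)}\,U^\top V\Sigma^{-\epsilon}V^\top U-\mathrm{Id}\big)\log_m(\Lambda)\Big)=0.$$ Moreover, the functions $\hat\Delta t(\epsilon)$ and $\check\Delta t(\epsilon)$ are continuous at $\epsilon=0$, and $$\hat\Delta t'(0)=\check\Delta t'(0)=-\frac{g_{A_1}\big(\underline{C},\underline{A_2}\big)}{d(A_1,A_2)}=0,$$ where $\underline{C}=\log_{A_1}(C)$ and $\underline{A_2}=\log_{A_1}(A_2)$ are the tangent vectors at $A_1$ pointing to $C$ and $A_2$.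
   Context: $\mathbf{S}_+(n)$ is the manifold of real symmetric positive-definite $n\times n$ matrices. $\log_m$ is the matrix logarithm, $\mathrm{Id}$ the identity matrix, and square roots are symmetric. Natural metric at $A\in\mathbf{S}_+(n)$: $g_A(X,Y)=\operatorname{tr}(XA^{-1}YA^{-1})$ for symmetric $X,Y$. Logarithm map: $\log_A(B)=A^{1/2}\log_m(A^{-1/2}BA^{-1/2})A^{1/2}$. Natural distance: $d(A,B)=\|\log_m(A^{-1/2}BA^{-1/2})\|_F$. Geodesic: $\varphi_{A\to B}(t)=A^{1/2}(A^{-1/2}BA^{-1/2})^{t}A^{1/2}$, $t\in\mathbb{R}$. For a matrix $\widehat C\in\mathbf{S}_+(n)$ to be projected, the three problems over $t\in(-\infty,\infty)$ and their solutions are: - natural projection: $t^*\in\operatorname{argmin}_t d(\varphi_{A_1\to A_2}(t),\widehat C)$; - reverse I-projection: $\hat t\in\operatorname{argmin}_t D_{KL}\big(N(0,\widehat C)\,\|\,N(0,\varphi_{A_1\to A_2}(t))\big)$; - I-projection: $\check t\in\operatorname{argmin}_t D_{KL}\big(N(0,\varphi_{A_1\to A_2}(t))\,\|\,N(0,\widehat C)\big)$. Here $D_{KL}$ is the Kullback–Leibler divergence, $D_{KL}(N(0,A)\,\|\,N(0,B))=\tfrac12\big(\operatorname{tr}(B^{-1}A)-n-\log\det(B^{-1}A)\big)$. The differences are $\hat\Delta t=\hat t-t^*$ and $\check\Delta t=\check t-t^*$, regarded as functions of the natural distance $\epsilon$ from the family to the matrix being projected. (In the supporting construction, the projected matrix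 at distance $\epsilon$ is $\varphi_{A_1\to\widehat C}(\epsilon)$, the point at parameter $\epsilon$ on the geodesic from $A_1$ through a matrix $\widehat C$ with $d(A_1,\widehat C)=1$.)
   Formalization: The displayed equations are proved to define the negatives of the differences (t* minus the KL solution), since the stated sign is false; A_1 ≠ A_2 is assumed; C is replaced by the point at parameter ε on the geodesic from A_1 to C, at distance |ε| d(A_1,C) from the family. *)

theory Defs
  imports "HOL-Analysis.Analysis"
begin

definition spd :: "real^'n^'n \<Rightarrow> bool" where
  "spd A \<longleftrightarrow> transpose A = A \<and> (\<forall>x. x \<noteq> 0 \<longrightarrow> 0 < x \<bullet> (A *v x))"

definition diagonal_matrix :: "real^'n^'n \<Rightarrow> bool" where
  "diagonal_matrix D \<longleftrightarrow> (\<forall>i j. i \<noteq> j \<longrightarrow> D $ i $ j = 0)"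

definition map_diagonal :: "(real \<Rightarrow> real) \<Rightarrow> real^'n^'n \<Rightarrow> real^'n^'n" where
  "map_diagonal f D = (\<chi> i j. if i = j then f (D $ i $ i) else 0)"

definition orthogonal_eigendecomposition ::
    "real^'n^'n \<Rightarrow> real^'n^'n \<Rightarrow> real^'n^'n \<Rightarrow> bool" where
  "orthogonal_eigendecomposition A U D \<longleftrightarrow>
     orthogonal_matrix U \<and> diagonal_matrix D \<and> A = U ** D ** transpose U"

text \<open>Functions of a symmetric matrix, applied to its eigenvalues. The result does not
  depend on the chosen decomposition (lemma \<open>spectral_fun_eq\<close> below); for matrices that have no
  orthogonal eigendecomposition the value is unspecified.\<close>

definition spectral_fun :: "(real \<Rightarrow> real) \<Rightarrow> real^'n^'n \<Rightarrow> real^'n^'n" where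
  "spectral_fun f A = (THE X. \<exists>U D. orthogonal_eigendecomposition A U D \<and>
                                    X = U ** map_diagonal f D ** transpose U)"

lemma diagonal_mult_nth:
  assumes "diagonal_matrix D"
  shows "(D ** W) $ i $ j = D $ i $ i * W $ i $ j"
proof -
  have "(D ** W) $ i $ j = (\<Sum>k\<in>UNIV. D $ i $ k * W $ k $ j)"
    by (simp add: matrix_matrix_mult_def)
  also have "\<dots> = (\<Sum>k\<in>UNIV. if k = i then D $ i $ i * W $ i $ j else 0)"
    using assms by (intro sum.cong) (auto simp: diagonal_matrix_def)
  finally show ?thesis by simp
qed

lemma mult_diagonal_nth:
  assumes "diagonal_matrix D"
  shows "(W ** D) $ i $ j = W $ i $ j * D $ j $ j"
proof -
  have "(W ** D) $ i $ j = (\<Sum>k\<in>UNIV. W $ i $ k * D $ k $ j)"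
    by (simp add: matrix_matrix_mult_def)
  also have "\<dots> = (\<Sum>k\<in>UNIV. if k = j then W $ i $ j * D $ j $ j else 0)"
    using assms by (intro sum.cong) (auto simp: diagonal_matrix_def)
  finally show ?thesis by simp
qed

lemma diagonal_map_diagonal: "diagonal_matrix (map_diagonal f D)"
  by (simp add: diagonal_matrix_def map_diagonal_def)

lemma spectral_fun_unique:
  fixes U V D E :: "real^'n^'n"
  assumes "orthogonal_eigendecomposition A U D" "orthogonal_eigendecomposition A V E"
  shows "U ** map_diagonal f D ** transpose U = V ** map_diagonal f E ** transpose V"
proof -
  define W where "W = transpose V ** U"
  have U: "transpose U ** U = mat 1" "U ** transpose U = mat 1"
    and V: "transpose V ** V = mat 1" "V ** transpose V = mat 1"
    and D: "diagonal_matrix D" and E: "diagonal_matrix E"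
    and eq: "U ** D ** transpose U = V ** E ** transpose V"
    using assms by (auto simp: orthogonal_eigendecomposition_def orthogonal_matrix_def)
  have "W ** D = transpose V ** (U ** D ** transpose U) ** U"
    by (metis W_def U(1) matrix_mul_assoc matrix_mul_rid)
  also have "\<dots> = E ** W"
    by (metis eq W_def V(1) matrix_mul_assoc matrix_mul_lid)
  finally have WD: "W ** D = E ** W" .
  have "(W ** map_diagonal f D) $ i $ j = (map_diagonal f E ** W) $ i $ j" for i j
  proof -
    have "W $ i $ j * D $ j $ j = E $ i $ i * W $ i $ j"
      using mult_diagonal_nth[OF D, of W i j] diagonal_mult_nth[OF E, of W i j] unfolding WD
      by (rule trans[OF sym])
    then have "W $ i $ j * f (D $ j $ j) = f (E $ i $ i) * W $ i $ j"
      by (cases "W $ i $ j = 0") auto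
    then show ?thesis
      by (simp add: mult_diagonal_nth diagonal_mult_nth diagonal_map_diagonal)
        (simp add: map_diagonal_def)
  qed
  then have W: "W ** map_diagonal f D = map_diagonal f E ** W"
    by (simp add: vec_eq_iff)
  have "U ** map_diagonal f D ** transpose U = V ** (W ** map_diagonal f D) ** transpose U"
    by (metis W_def V(2) matrix_mul_assoc matrix_mul_lid)
  also have "\<dots> = V ** map_diagonal f E ** transpose V"
    unfolding W by (metis W_def U(2) matrix_mul_assoc matrix_mul_rid)
  finally show ?thesis .
qed

lemma spectral_fun_eq:
  assumes "orthogonal_eigendecomposition A U D"
  shows "spectral_fun f A = U ** map_diagonal f D ** transpose U"
  unfolding spectral_fun_def
  using assms spectral_fun_unique by (intro the_equality) blast+

definition mat_log :: "real^'n^'n \<Rightarrow> real^'n^'n" where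
  "mat_log = spectral_fun ln"

definition mat_powr :: "real^'n^'n \<Rightarrow> real \<Rightarrow> real^'n^'n" (infixr \<open>mpowr\<close> 80) where
  "A mpowr t = spectral_fun (\<lambda>x. x powr t) A"

definition natural_metric :: "real^'n^'n \<Rightarrow> real^'n^'n \<Rightarrow> real^'n^'n \<Rightarrow> real" where
  "natural_metric A X Y = trace (X ** matrix_inv A ** Y ** matrix_inv A)"

definition log_map :: "real^'n^'n \<Rightarrow> real^'n^'n \<Rightarrow> real^'n^'n" where
  "log_map A B =
     A mpowr (1/2) ** mat_log (A mpowr (-1/2) ** B ** A mpowr (-1/2)) ** A mpowr (1/2)"

text \<open>The library's \<open>norm\<close> on \<open>real^'n^'n\<close> is the Frobenius norm (not the operator norm).\<close>

definition natural_dist :: "real^'n^'n \<Rightarrow> real^'n^'n \<Rightarrow> real" where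
  "natural_dist A B = norm (mat_log (A mpowr (-1/2) ** B ** A mpowr (-1/2)))"

definition geodesic :: "real^'n^'n \<Rightarrow> real^'n^'n \<Rightarrow> real \<Rightarrow> real^'n^'n" where
  "geodesic A B t =
     A mpowr (1/2) ** (A mpowr (-1/2) ** B ** A mpowr (-1/2)) mpowr t ** A mpowr (1/2)"

text \<open>Kullback--Leibler divergence of the centred Gaussian with covariance \<open>A\<close> from the one with
  covariance \<open>B\<close>.\<close>

definition KL_gauss :: "real^'n^'n \<Rightarrow> real^'n^'n \<Rightarrow> real" where
  "KL_gauss A B =
     (trace (matrix_inv B ** A) - real CARD('n) - ln (det (matrix_inv B ** A))) / 2"

definition is_natural_projection :: "real^'n^'n \<Rightarrow> real^'n^'n \<Rightarrow> real^'n^'n \<Rightarrow> real \<Rightarrow> bool" where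
  "is_natural_projection A1 A2 B =
     is_arg_min (\<lambda>t. natural_dist (geodesic A1 A2 t) B) (\<lambda>t. True)"

definition is_reverse_I_projection :: "real^'n^'n \<Rightarrow> real^'n^'n \<Rightarrow> real^'n^'n \<Rightarrow> real \<Rightarrow> bool" where
  "is_reverse_I_projection A1 A2 B =
     is_arg_min (\<lambda>t. KL_gauss B (geodesic A1 A2 t)) (\<lambda>t. True)"

definition is_I_projection :: "real^'n^'n \<Rightarrow> real^'n^'n \<Rightarrow> real^'n^'n \<Rightarrow> real \<Rightarrow> bool" where
  "is_I_projection A1 A2 B =
     is_arg_min (\<lambda>t. KL_gauss (geodesic A1 A2 t) B) (\<lambda>t. True)"

definition natural_projection :: "real^'n^'n \<Rightarrow> real^'n^'n \<Rightarrow> real^'n^'n \<Rightarrow> real" where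
  "natural_projection A1 A2 B = (THE t. is_natural_projection A1 A2 B t)"

definition reverse_I_projection :: "real^'n^'n \<Rightarrow> real^'n^'n \<Rightarrow> real^'n^'n \<Rightarrow> real" where
  "reverse_I_projection A1 A2 B = (THE t. is_reverse_I_projection A1 A2 B t)"

definition I_projection :: "real^'n^'n \<Rightarrow> real^'n^'n \<Rightarrow> real^'n^'n \<Rightarrow> real" where
  "I_projection A1 A2 B = (THE t. is_I_projection A1 A2 B t)"

text \<open>The differences below are functions of a real parameter \<open>\<epsilon>\<close>: the projected matrix is
  \<open>geodesic A1 C \<epsilon>\<close>. Its distance from \<open>A1\<close> is \<open>\<bar>\<epsilon>\<bar> * natural_dist A1 C\<close>, so \<open>\<epsilon> \<ge> 0\<close> is that
  distance itself when \<open>C\<close> is normalised by \<open>natural_dist A1 C = 1\<close>.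

  They are oriented as KL solution minus natural solution. For \<open>natural_projection = 0\<close>
  the first-order condition of the reverse I-projection reads
  \<open>trace ((U\<^sup>T V \<Sigma>\<^sup>\<epsilon> V\<^sup>T U \<Lambda>\<^sup>-\<^sup>t - Id) log \<Lambda>) = 0\<close>, and that of the I-projection
  \<open>trace ((\<Lambda>\<^sup>t U\<^sup>T V \<Sigma>\<^sup>-\<^sup>\<epsilon> V\<^sup>T U - Id) log \<Lambda>) = 0\<close>. Hence the solutions of the same equations with
  \<open>\<Lambda>\<^sup>t\<close> in the first and \<open>\<Lambda>\<^sup>-\<^sup>t\<close> in the second are the negatives of these differences.\<close>

definition reverse_I_diff :: "real^'n^'n \<Rightarrow> real^'n^'n \<Rightarrow> real^'n^'n \<Rightarrow> real \<Rightarrow> real" where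
  "reverse_I_diff A1 A2 C \<epsilon> =
     reverse_I_projection A1 A2 (geodesic A1 C \<epsilon>) - natural_projection A1 A2 (geodesic A1 C \<epsilon>)"

definition I_diff :: "real^'n^'n \<Rightarrow> real^'n^'n \<Rightarrow> real^'n^'n \<Rightarrow> real \<Rightarrow> real" where
  "I_diff A1 A2 C \<epsilon> =
     I_projection A1 A2 (geodesic A1 C \<epsilon>) - natural_projection A1 A2 (geodesic A1 C \<epsilon>)"

end

theory Submission
  imports Defs "HOL-Real_Asymp.Real_Asymp"
begin

text \<open>
  Conjugating by \<open>A\<^sub>1\<^sup>-\<^sup>1\<^sup>/\<^sup>2\<close> turns the two geodesics into powers \<open>M\<^sup>t\<close> and \<open>N\<^sup>\<epsilon>\<close>. If \<open>t = 0\<close> minimizes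
  \<open>d(M\<^sup>t, N)\<close>, the first-order condition says that \<open>log M\<close> and \<open>log N\<close> are orthogonal. The exponential
  metric increasing property \<open>\<parallel>log A - log B\<parallel> \<le> d(A, B)\<close> then gives
  \<open>d(M\<^sup>t, N\<^sup>\<epsilon>)\<^sup>2 \<ge> t\<^sup>2 \<parallel>log M\<parallel>\<^sup>2 + \<epsilon>\<^sup>2 \<parallel>log N\<parallel>\<^sup>2\<close>, with equality at \<open>t = 0\<close>, so the natural projection of
  every point of the geodesic towards \<open>C\<close> is \<open>A\<^sub>1\<close>. In an eigenbasis of \<open>M\<close> each of the two divergences is, up to
  constants, \<open>(\<Sum>i. a i * exp (- t * l i)) + t * (\<Sum>i. l i)\<close> with positive \<open>a i\<close> (and \<open>-l\<close> for \<open>l\<close>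
  in the I-projection): a strictly convex function with a unique critical point. The derivative of that point in \<open>\<epsilon>\<close> at \<open>0\<close> is a multiple of the inner
  product of \<open>log M\<close> and \<open>log N\<close>, and hence vanishes.
\<close>

subsection \<open>The spectral theorem for real symmetric matrices\<close>

lemma orthogonal_matrixD:
  fixes U :: "real^'n^'n"
  assumes "orthogonal_matrix U"
  shows "transpose U ** U = mat 1" "U ** transpose U = mat 1"
  using assms by (auto simp: orthogonal_matrix_def)

lemma orthogonal_matrix_cancel:
  fixes U :: "real^'n^'n"
  assumes "orthogonal_matrix U"
  shows "transpose U ** (U ** X) = X" "U ** (transpose U ** X) = X"
  using assms by (simp_all add: matrix_mul_assoc orthogonal_matrixD)

lemma matrix_inv_eqI:
  fixes A :: "real^'n^'n"
  assumes "A ** B = mat 1"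
  shows "matrix_inv A = B"
proof -
  have BA: "B ** A = mat 1"
    using assms by (simp add: matrix_left_right_inverse)
  have "A ** matrix_inv A = mat 1 \<and> matrix_inv A ** A = mat 1"
    unfolding matrix_inv_def by (rule someI[of _ B]) (use assms BA in auto)
  then show ?thesis
    by (metis BA matrix_mul_assoc matrix_mul_lid matrix_mul_rid)
qed

lemma inner_matrix_vector_transpose:
  fixes A :: "real^'n^'m"
  shows "x \<bullet> (A *v y) = (transpose A *v x) \<bullet> y"
  by (simp add: dot_lmul_matrix)

lemma trace_mult_transpose:
  fixes X Y :: "real^'n^'n"
  shows "trace (X ** transpose Y) = X \<bullet> Y"
  by (simp add: trace_def matrix_matrix_mult_def transpose_def inner_vec_def)

lemma quadratic_nonpos_imp_linear_zero:
  fixes a b :: real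
  assumes "\<And>t. a * t + b * t\<^sup>2 \<le> 0"
  shows "a = 0"
proof (rule ccontr)
  assume "a \<noteq> 0"
  \<comment> \<open>The witness has the sign of \<open>a\<close> and is small enough for the linear
    term to outweigh the quadratic one, whatever the sign of \<open>b\<close>.\<close>
  define t where "t = a / (1 + \<bar>b\<bar>)"
  have *: "a * t + b * t\<^sup>2 = a\<^sup>2 * (1 + \<bar>b\<bar> + b) / (1 + \<bar>b\<bar>)\<^sup>2"
    by (simp add: t_def power2_eq_square divide_simps) (simp add: algebra_simps)
  have "0 < a\<^sup>2 * (1 + \<bar>b\<bar> + b) / (1 + \<bar>b\<bar>)\<^sup>2"
    using \<open>a \<noteq> 0\<close> by (intro divide_pos_pos mult_pos_pos) auto
  with assms[of t] * show False by simp
qed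

text \<open>A maximizer \<open>v\<close> of the Rayleigh quotient on the unit sphere of
  \<open>W\<close> is an eigenvector. The residual \<open>w = A *v v - c *\<^sub>R v\<close> stays
  in \<open>W\<close> and is orthogonal to \<open>v\<close>; moving from \<open>v\<close> along
  \<open>w\<close> changes the quadratic form at first order by \<open>2 * (w \<bullet> w)\<close>,
  which maximality forces to be 0.\<close>

lemma symmetric_eigenvector_in_subspace:
  fixes A :: "real^'n^'n"
  assumes sym: "transpose A = A" and W: "subspace W" "\<And>x. x \<in> W \<Longrightarrow> A *v x \<in> W"
    and z: "z \<in> W" "z \<noteq> 0"
  obtains v c where "v \<in> W" "norm v = 1" "A *v v = c *\<^sub>R v"
proof -
  let ?S = "sphere 0 1 \<inter> W"
  have "compact ?S"
    by (intro compact_Int_closed compact_sphere closed_subspace W)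
  moreover have "z /\<^sub>R norm z \<in> ?S"
    using z W(1) by (simp add: subspace_mul)
  then have "?S \<noteq> {}" by blast
  moreover have "continuous_on ?S (\<lambda>x. x \<bullet> (A *v x))"
    by (intro continuous_intros linear_continuous_on) auto
  ultimately obtain v where v: "v \<in> ?S" and max: "\<And>x. x \<in> ?S \<Longrightarrow> x \<bullet> (A *v x) \<le> v \<bullet> (A *v v)"
    using continuous_attains_sup[of ?S "\<lambda>x. x \<bullet> (A *v x)"] by blast
  define c where "c = v \<bullet> (A *v v)"
  have vW: "v \<in> W" and nv: "norm v = 1" "v \<bullet> v = 1"
    using v by (auto simp: norm_eq_1)
  have le: "x \<bullet> (A *v x) \<le> c * (x \<bullet> x)" if "x \<in> W" for x
  proof (cases "x = 0")
    case False
    have "x /\<^sub>R norm x \<in> ?S"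
      using that False W(1) by (auto intro: subspace_mul)
    from max[OF this] False show ?thesis
      by (simp add: c_def matrix_vector_mult_scaleR dot_square_norm power2_eq_square field_simps)
  qed simp
  define w where "w = A *v v - c *\<^sub>R v"
  have wW: "w \<in> W"
    unfolding w_def using W vW by (intro subspace_diff subspace_mul) auto
  have wv: "w \<bullet> v = 0"
    using nv by (simp add: w_def inner_diff_left c_def inner_commute[of "A *v v"])
  have vAw: "v \<bullet> (A *v w) = w \<bullet> (A *v v)"
    by (subst inner_matrix_vector_transpose) (simp only: sym inner_commute)
  have wAv: "w \<bullet> (A *v v) = w \<bullet> w"
  proof -
    have "A *v v = w + c *\<^sub>R v" by (simp add: w_def)
    then show ?thesis by (simp add: inner_add_right wv)
  qed
  have "2 * (w \<bullet> w) * t + (w \<bullet> (A *v w) - c * (w \<bullet> w)) * t\<^sup>2 \<le> 0" for t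
  proof -
    have "v + t *\<^sub>R w \<in> W"
      using W vW wW by (intro subspace_add subspace_mul)
    from le[OF this] show ?thesis
      using wv vAw wAv nv
      by (simp add: inner_commute[of v w] c_def[symmetric] power2_eq_square algebra_simps)
  qed
  then have "2 * (w \<bullet> w) = 0"
    by (rule quadratic_nonpos_imp_linear_zero)
  then have "A *v v = c *\<^sub>R v" by (simp add: w_def)
  with vW nv show ?thesis using that by blast
qed

text \<open>Induction on the dimension: split off one unit eigenvector. By symmetry of
  \<open>A\<close> its orthogonal complement within \<open>W\<close> is again invariant, and it has
  smaller dimension.\<close>

lemma symmetric_eigenbasis_of_subspace:
  fixes A :: "real^'n^'n"
  assumes sym: "transpose A = A" and "subspace W" "\<And>x. x \<in> W \<Longrightarrow> A *v x \<in> W"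
  shows "\<exists>B. pairwise orthogonal B \<and> (\<forall>b\<in>B. norm b = 1 \<and> (\<exists>c. A *v b = c *\<^sub>R b)) \<and> span B = W"
  using assms(2,3)
proof (induction "dim W" arbitrary: W rule: less_induct)
  case less
  show ?case
  proof (cases "W \<subseteq> {0}")
    case True
    then have "span {} = W" using less.prems(1) subspace_0 by auto
    then show ?thesis by (intro exI[of _ "{}"]) auto
  next
    case False
    then obtain z where "z \<in> W" "z \<noteq> 0" by auto
    from symmetric_eigenvector_in_subspace[OF sym less.prems this]
    obtain v c where v: "v \<in> W" "norm v = 1" and Av: "A *v v = c *\<^sub>R v" by blast
    define W' where "W' = W \<inter> {x. v \<bullet> x = 0}"
    have sW': "subspace W'"
      unfolding W'_def using less.prems(1) subspace_hyperplane by (rule subspace_inter)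
    have inv: "A *v x \<in> W'" if "x \<in> W'" for x
    proof -
      have "v \<bullet> (A *v x) = (A *v v) \<bullet> x"
        by (subst inner_matrix_vector_transpose) (simp only: sym)
      then show ?thesis using that less.prems(2) by (simp add: W'_def Av)
    qed
    have "v \<notin> W'" using v by (auto simp: W'_def)
    then have "W' \<subset> W" using v unfolding W'_def by blast
    then have "dim W' < dim W"
      using less.prems(1) sW' by (metis dim_psubset span_eq_iff)
    from less.hyps[OF this sW' inv] obtain B where
      B: "pairwise orthogonal B" "\<forall>b\<in>B. norm b = 1 \<and> (\<exists>c. A *v b = c *\<^sub>R b)" "span B = W'"
      by blast
    have BW': "B \<subseteq> W'" using B(3) span_superset by blast
    have "pairwise orthogonal (insert v B)"
      using B(1) BW' by (auto simp: pairwise_insert orthogonal_def W'_def inner_commute)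
    moreover have "span (insert v B) = W"
    proof
      show "span (insert v B) \<subseteq> W"
        using BW' v less.prems(1) by (intro span_minimal) (auto simp: W'_def)
      show "W \<subseteq> span (insert v B)"
      proof
        fix x assume "x \<in> W"
        then have "x - (v \<bullet> x) *\<^sub>R v \<in> W'"
          using v less.prems(1)
          by (auto simp: W'_def inner_diff_right norm_eq_1 intro!: subspace_diff subspace_mul)
        then show "x \<in> span (insert v B)"
          using B(3) by (auto simp: span_insert)
      qed
    qed
    ultimately show ?thesis
      using B(2) v(2) Av by (intro exI[of _ "insert v B"]) auto
  qed
qed

lemma symmetric_orthogonal_eigendecomposition:
  fixes A :: "real^'n^'n"
  assumes "transpose A = A"
  shows "\<exists>U D. orthogonal_eigendecomposition A U D"
proof -
  obtain B where B: "pairwise orthogonal B" "\<And>b. b \<in> B \<Longrightarrow> norm b = 1"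
      "\<And>b. b \<in> B \<Longrightarrow> \<exists>c. A *v b = c *\<^sub>R b" "span B = (UNIV :: (real^'n) set)"
    using symmetric_eigenbasis_of_subspace[OF assms subspace_UNIV] by auto
  have "independent B"
    using B(1,2) by (intro pairwise_orthogonal_independent) force+
  then have "finite B" "card B = CARD('n)"
    using dim_eq_card[of B UNIV] B(4) by (auto simp: independent_imp_finite)
  then obtain f :: "'n \<Rightarrow> real^'n" where f: "bij_betw f UNIV B"
    by (metis finite_class.finite_UNIV finite_same_card_bij)
  have fB: "f i \<in> B" for i using f by (auto simp: bij_betw_def)
  have inner_f: "f i \<bullet> f j = (if i = j then 1 else 0)" for i j
  proof (cases "i = j")
    case True
    then show ?thesis using B(2)[OF fB] by (simp add: norm_eq_1)
  next
    case False
    then have "f i \<noteq> f j" using f by (auto simp: bij_betw_def inj_def)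
    with False show ?thesis using B(1) fB by (auto simp: pairwise_def orthogonal_def)
  qed
  obtain c where c: "\<And>i. A *v f i = c i *\<^sub>R f i"
    using B(3)[OF fB] by metis
  define U where "U = (\<chi> i j. f j $ i)"
  define D :: "real^'n^'n" where "D = (\<chi> i j. if i = j then c i else 0)"
  have D: "diagonal_matrix D" by (simp add: D_def diagonal_matrix_def)
  have "(transpose U ** U) $ i $ j = mat 1 $ i $ j" for i j
    using inner_f[of i j]
    by (simp add: U_def matrix_matrix_mult_def transpose_def inner_vec_def mat_def)
  then have U: "orthogonal_matrix U"
    by (simp add: orthogonal_matrix vec_eq_iff)
  have "(A ** U) $ i $ j = (U ** D) $ i $ j" for i j
  proof -
    have "(A ** U) $ i $ j = (A *v f j) $ i"
      by (simp add: U_def matrix_matrix_mult_def matrix_vector_mult_def)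
    then show ?thesis
      by (simp add: c mult_diagonal_nth[OF D]) (simp add: U_def D_def)
  qed
  then have "A ** U = U ** D" by (simp add: vec_eq_iff)
  then have "A = U ** D ** transpose U"
    using orthogonal_matrixD(2)[OF U] by (metis matrix_mul_assoc matrix_mul_rid)
  with U D show ?thesis unfolding orthogonal_eigendecomposition_def by blast
qed

subsection \<open>Matrices in an orthonormal eigenbasis\<close>

definition diag :: "('n::finite \<Rightarrow> real) \<Rightarrow> real^'n^'n" where
  "diag d = (\<chi> i j. if i = j then d i else 0)"

text \<open>Keeping the spectrum as a plain function beside the eigenbasis makes functional
  calculus, products, inverses and traces pointwise operations on that function.\<close>

definition eigmat :: "real^'n^'n \<Rightarrow> ('n::finite \<Rightarrow> real) \<Rightarrow> real^'n^'n" where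
  "eigmat U d = U ** diag d ** transpose U"

lemma diagonal_diag [simp]: "diagonal_matrix (diag d)"
  by (simp add: diag_def diagonal_matrix_def)

lemma diag_nth [simp]: "diag d $ i $ j = (if i = j then d i else 0)"
  by (simp add: diag_def)

lemma map_diagonal_diag: "map_diagonal g (diag d) = diag (\<lambda>i. g (d i))"
  by (simp add: map_diagonal_def diag_def vec_eq_iff)

lemma diagonal_matrix_eq_diag: "diagonal_matrix D \<Longrightarrow> D = diag (\<lambda>i. D $ i $ i)"
  by (simp add: diag_def vec_eq_iff diagonal_matrix_def)

lemma transpose_diag [simp]: "transpose (diag d) = diag d"
  by (simp add: diag_def transpose_def vec_eq_iff)

lemma diag_mult: "diag a ** diag b = diag (\<lambda>i. a i * b i)"
  by (simp add: vec_eq_iff diagonal_mult_nth)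

lemma diag_1: "diag (\<lambda>_. 1) = mat 1"
  by (simp add: vec_eq_iff mat_def)

lemma det_diag: "det (diag d) = prod d UNIV"
  by (subst det_diagonal) auto

lemma eigmat_mat_1: "eigmat (mat 1) d = diag d"
  by (simp add: eigmat_def)

lemma orthogonal_eigendecomposition_eigmat:
  "orthogonal_matrix U \<Longrightarrow> orthogonal_eigendecomposition (eigmat U d) U (diag d)"
  by (simp add: orthogonal_eigendecomposition_def eigmat_def)

lemma orthogonal_eigendecompositionE:
  assumes "orthogonal_eigendecomposition A U D"
  obtains d where "orthogonal_matrix U" "D = diag d" "A = eigmat U d"
  using assms diagonal_matrix_eq_diag[of D]
  unfolding orthogonal_eigendecomposition_def eigmat_def by metis

lemma spectral_fun_eigmat:
  "orthogonal_matrix U \<Longrightarrow> spectral_fun g (eigmat U d) = eigmat U (\<lambda>i. g (d i))"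
  by (subst spectral_fun_eq[OF orthogonal_eigendecomposition_eigmat])
    (simp_all add: map_diagonal_diag eigmat_def)

lemma eigmat_mult:
  "orthogonal_matrix U \<Longrightarrow> eigmat U a ** eigmat U b = eigmat U (\<lambda>i. a i * b i)"
  by (simp add: eigmat_def diag_mult[symmetric] matrix_mul_assoc[symmetric] orthogonal_matrix_cancel)

lemma eigmat_1: "orthogonal_matrix U \<Longrightarrow> eigmat U (\<lambda>_. 1) = mat 1"
  by (simp add: eigmat_def diag_1 orthogonal_matrixD)

lemma transpose_eigmat [simp]: "transpose (eigmat U d) = eigmat U d"
  by (simp add: eigmat_def matrix_transpose_mul matrix_mul_assoc)

lemma trace_eigmat: "orthogonal_matrix U \<Longrightarrow> trace (eigmat U d) = sum d UNIV"
  by (subst eigmat_def, subst trace_mul_sym)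
    (simp add: orthogonal_matrix_cancel, simp add: trace_def)

lemma det_eigmat:
  assumes "orthogonal_matrix U"
  shows "det (eigmat U d) = prod d UNIV"
proof -
  have "det U * det U = 1"
    using orthogonal_matrixD(2)[OF assms] by (metis det_I det_mul det_transpose)
  then show ?thesis by (simp add: eigmat_def det_mul det_diag)
qed

lemma matrix_inv_eigmat:
  assumes "orthogonal_matrix U" "\<And>i. d i \<noteq> 0"
  shows "matrix_inv (eigmat U d) = eigmat U (\<lambda>i. inverse (d i))"
  by (rule matrix_inv_eqI) (simp add: eigmat_mult assms eigmat_1)

lemma norm_eigmat:
  assumes "orthogonal_matrix U"
  shows "(norm (eigmat U d))\<^sup>2 = (\<Sum>i\<in>UNIV. (d i)\<^sup>2)"
  using trace_mult_transpose[of "eigmat U d" "eigmat U d"]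
  by (simp add: dot_square_norm eigmat_mult[OF assms] trace_eigmat[OF assms] power2_eq_square)

lemma orthogonal_conj_eigmat:
  "Q ** eigmat U d ** transpose Q = eigmat (Q ** U) d"
  by (simp add: eigmat_def matrix_transpose_mul matrix_mul_assoc)

text \<open>The squared entries of \<open>U\<^sup>T V\<close> form a doubly stochastic matrix. It turns traces of products of
  functions of two symmetric matrices into double sums over their spectra.\<close>

definition overlap :: "real^'n^'n \<Rightarrow> real^'n^'n \<Rightarrow> 'n \<Rightarrow> 'n \<Rightarrow> real" where
  "overlap U V i j = ((transpose U ** V) $ i $ j)\<^sup>2"

lemma overlap_nonneg: "0 \<le> overlap U V i j"
  by (simp add: overlap_def)

lemma transpose_conj_eigmat_nth:
  "(transpose U ** eigmat V b ** U) $ i $ i = (\<Sum>j\<in>UNIV. overlap U V i j * b j)"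
proof -
  let ?W = "transpose U ** V"
  have "transpose U ** eigmat V b ** U = ?W ** diag b ** transpose ?W"
    by (simp add: eigmat_def matrix_transpose_mul matrix_mul_assoc)
  moreover have "(X ** transpose ?W) $ i $ i = (\<Sum>j\<in>UNIV. X $ i $ j * ?W $ i $ j)" for X
    by (simp add: matrix_matrix_mult_def[of X] transpose_def)
  ultimately show ?thesis
    by (simp add: mult_diagonal_nth overlap_def power2_eq_square mult_ac)
qed

lemma trace_eigmat_mult:
  "trace (eigmat U a ** eigmat V b) = (\<Sum>i\<in>UNIV. \<Sum>j\<in>UNIV. overlap U V i j * (a i * b j))"
proof -
  have "trace (eigmat U a ** eigmat V b) = trace (U ** (diag a ** (transpose U ** eigmat V b)))"
    by (simp add: eigmat_def[of U] matrix_mul_assoc)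
  also have "\<dots> = trace (diag a ** (transpose U ** eigmat V b ** U))"
    by (subst trace_mul_sym) (simp add: matrix_mul_assoc)
  finally show ?thesis
    by (simp add: trace_def diagonal_mult_nth transpose_conj_eigmat_nth sum_distrib_left mult_ac)
qed

lemma overlap_sum_right:
  assumes "orthogonal_matrix U" "orthogonal_matrix V"
  shows "(\<Sum>j\<in>UNIV. overlap U V i j) = 1"
  using transpose_conj_eigmat_nth[of U V "\<lambda>_. 1" i]
  by (simp add: eigmat_1[OF assms(2)] orthogonal_matrixD[OF assms(1)]) (simp add: mat_def)

lemma overlap_sum_left:
  assumes "orthogonal_matrix U" "orthogonal_matrix V"
  shows "(\<Sum>i\<in>UNIV. overlap U V i j) = 1"
proof -
  have "transpose V ** U = transpose (transpose U ** V)"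
    by (simp add: matrix_transpose_mul)
  then have "overlap V U j i = overlap U V i j" for i
    unfolding overlap_def by (simp only: transpose_def vec_lambda_beta)
  then show ?thesis using overlap_sum_right[OF assms(2,1), of j] by simp
qed

lemma overlap_sum_fst:
  assumes "orthogonal_matrix U" "orthogonal_matrix V"
  shows "(\<Sum>i\<in>UNIV. \<Sum>j\<in>UNIV. overlap U V i j * a i) = sum a UNIV"
  by (simp add: sum_distrib_right[symmetric] overlap_sum_right[OF assms])

lemma overlap_sum_snd:
  assumes "orthogonal_matrix U" "orthogonal_matrix V"
  shows "(\<Sum>i\<in>UNIV. \<Sum>j\<in>UNIV. overlap U V i j * b j) = sum b UNIV"
  by (subst sum.swap) (simp add: sum_distrib_right[symmetric] overlap_sum_left[OF assms])

section \<open>Positive definiteness read off the spectrum\<close>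

lemma spd_eigmat_pos:
  assumes U: "orthogonal_matrix U" and A: "spd (eigmat U d)"
  shows "0 < d i"
proof -
  have e: "transpose U *v (U *v axis i 1) = axis i 1"
    by (simp only: matrix_vector_mul_assoc orthogonal_matrixD[OF U] matrix_vector_mul_lid)
  then have "U *v axis i 1 \<noteq> 0"
    by (metis axis_eq_0_iff matrix_vector_mult_0_right zero_neq_one)
  then have "0 < (U *v axis i 1) \<bullet> (eigmat U d *v (U *v axis i 1))"
    using A unfolding spd_def by blast
  also have "eigmat U d *v (U *v axis i 1) = U *v (diag d *v axis i 1)"
    unfolding eigmat_def by (simp only: matrix_vector_mul_assoc[symmetric] e)
  also have "(U *v axis i 1) \<bullet> \<dots> = axis i 1 \<bullet> (diag d *v axis i 1)"
    by (subst inner_matrix_vector_transpose) (simp only: e)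
  also have "\<dots> = d i"
    by (simp add: inner_axis' matrix_vector_mult_basis column_def)
  finally show ?thesis .
qed

lemma spd_eigmatE:
  assumes "spd A"
  obtains U d where "orthogonal_matrix U" "\<And>i. 0 < d i" "A = eigmat U d"
proof -
  obtain U D where "orthogonal_eigendecomposition A U D"
    using symmetric_orthogonal_eigendecomposition assms unfolding spd_def by blast
  then obtain d where U: "orthogonal_matrix U" and A: "A = eigmat U d"
    by (rule orthogonal_eigendecompositionE)
  have "0 < d i" for i
    using U assms unfolding A by (rule spd_eigmat_pos)
  with U A that show ?thesis by metis
qed

text \<open>The quadratic form is the squared length of \<open>R *v x\<close> for the symmetric
  square root \<open>R\<close>, and \<open>R\<close> is injective because it has an explicit
  inverse.\<close>

lemma spd_eigmat:
  assumes "orthogonal_matrix U" "\<And>i. 0 < d i"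
  shows "spd (eigmat U d)"
proof -
  have "0 < x \<bullet> (eigmat U d *v x)" if "x \<noteq> 0" for x
  proof -
    define R where "R = eigmat U (\<lambda>i. sqrt (d i))"
    have "eigmat U d = R ** R"
      using assms by (simp add: R_def eigmat_mult less_imp_le)
    then have "x \<bullet> (eigmat U d *v x) = (R *v x) \<bullet> (R *v x)"
      by (simp only: matrix_vector_mul_assoc[symmetric] inner_matrix_vector_transpose[of x])
        (simp only: R_def transpose_eigmat)
    moreover have "R *v x \<noteq> 0"
    proof
      assume "R *v x = 0"
      moreover have "eigmat U (\<lambda>i. inverse (sqrt (d i))) ** R = mat 1"
        using assms by (simp add: R_def eigmat_mult eigmat_1 less_imp_neq[symmetric])
      ultimately show False
        using that by (metis matrix_vector_mul_assoc matrix_vector_mul_lid matrix_vector_mult_0_right)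
    qed
    ultimately show ?thesis by simp
  qed
  then show ?thesis by (simp add: spd_def)
qed

lemma spd_congruence:
  fixes P :: "real^'n^'n"
  assumes "spd A" "invertible P"
  shows "spd (P ** A ** transpose P)"
proof -
  have "0 < x \<bullet> (P ** A ** transpose P *v x)" if "x \<noteq> 0" for x
  proof -
    have "transpose P *v x \<noteq> 0"
      using \<open>invertible P\<close> that
      by (metis invertible_def matrix_transpose_mul matrix_vector_mul_assoc matrix_vector_mul_lid
          matrix_vector_mult_0_right transpose_mat)
    then have "0 < (transpose P *v x) \<bullet> (A *v (transpose P *v x))"
      using assms(1) unfolding spd_def by blast
    then show ?thesis
      by (simp only: matrix_vector_mul_assoc[symmetric] inner_matrix_vector_transpose[of x P])
  qed
  moreover have "transpose (P ** A ** transpose P) = P ** A ** transpose P"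
    using assms(1) by (simp add: spd_def matrix_transpose_mul matrix_mul_assoc)
  ultimately show ?thesis by (simp add: spd_def)
qed

lemma mat_log_eigmat: "orthogonal_matrix U \<Longrightarrow> mat_log (eigmat U d) = eigmat U (\<lambda>i. ln (d i))"
  by (simp add: mat_log_def spectral_fun_eigmat)

lemma mpowr_eigmat: "orthogonal_matrix U \<Longrightarrow> eigmat U d mpowr t = eigmat U (\<lambda>i. d i powr t)"
  by (simp add: mat_powr_def spectral_fun_eigmat)

subsection \<open>Powers and logarithms of positive definite matrices\<close>

lemma spd_transpose: "spd A \<Longrightarrow> transpose A = A"
  by (simp add: spd_def)

lemma spd_mpowr:
  assumes "spd A"
  shows "spd (A mpowr t)"
  using assms by (elim spd_eigmatE) (auto simp: mpowr_eigmat less_imp_neq[symmetric] intro!: spd_eigmat)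

lemma transpose_mpowr: "spd A \<Longrightarrow> transpose (A mpowr t) = A mpowr t"
  by (simp add: spd_transpose spd_mpowr)

lemma mpowr_add:
  assumes "spd A"
  shows "A mpowr s ** A mpowr t = A mpowr (s + t)"
  using assms by (elim spd_eigmatE) (auto simp: mpowr_eigmat eigmat_mult powr_add)

lemma mpowr_add_left:
  assumes "spd A"
  shows "A mpowr s ** (A mpowr t ** X) = A mpowr (s + t) ** X"
  using assms by (simp add: matrix_mul_assoc mpowr_add)

lemma mpowr_0:
  assumes "spd A"
  shows "A mpowr 0 = mat 1"
  using assms by (elim spd_eigmatE) (auto simp: mpowr_eigmat eigmat_1 less_imp_neq[symmetric])

lemma mpowr_1:
  assumes "spd A"
  shows "A mpowr 1 = A"
  using assms by (elim spd_eigmatE) (auto simp: mpowr_eigmat less_imp_le)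

lemma matrix_inv_mpowr:
  assumes "spd A"
  shows "matrix_inv (A mpowr t) = A mpowr (- t)"
  by (rule matrix_inv_eqI) (simp add: mpowr_add mpowr_0 assms)

lemma matrix_inv_spd:
  assumes "spd A"
  shows "matrix_inv A = A mpowr (-1)"
  using matrix_inv_mpowr[OF assms, of 1] by (simp add: mpowr_1 assms)

lemma invertible_mpowr:
  assumes "spd A"
  shows "invertible (A mpowr t)"
  unfolding invertible_def
  by (intro exI[of _ "A mpowr (- t)"]) (simp add: mpowr_add mpowr_0 assms)

lemma mat_1_mpowr: "mat 1 mpowr t = mat 1"
  using mpowr_eigmat[of "mat 1" "\<lambda>_. 1" t] by (simp add: orthogonal_matrix_id eigmat_1)

lemma scaleR_eigmat: "c *\<^sub>R eigmat U d = eigmat U (\<lambda>i. c * d i)"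
proof -
  have "c *\<^sub>R diag d = diag (\<lambda>i. c * d i)"
    by (simp add: vec_eq_iff)
  then show ?thesis
    by (simp add: eigmat_def scalar_matrix_assoc matrix_scalar_ac flip: \<open>c *\<^sub>R diag d = _\<close>)
qed

lemma mat_log_mpowr:
  assumes "spd A"
  shows "mat_log (A mpowr t) = t *\<^sub>R mat_log A"
  using assms by (elim spd_eigmatE) (auto simp: mpowr_eigmat mat_log_eigmat scaleR_eigmat)

lemma transpose_mat_log:
  assumes "spd A"
  shows "transpose (mat_log A) = mat_log A"
  using assms by (elim spd_eigmatE) (auto simp: mat_log_eigmat)

lemma inner_eigmat: "eigmat U a \<bullet> eigmat V b = (\<Sum>i\<in>UNIV. \<Sum>j\<in>UNIV. overlap U V i j * (a i * b j))"
  using trace_mult_transpose[of "eigmat U a" "eigmat V b"] by (simp add: trace_eigmat_mult)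

text \<open>Since the overlaps are doubly stochastic, the two squared norms can be spread over the
  same double sum as the cross term, where the three terms combine to squares.\<close>

lemma norm_eigmat_diff:
  assumes "orthogonal_matrix U" "orthogonal_matrix V"
  shows "(norm (eigmat U a - eigmat V b))\<^sup>2
    = (\<Sum>i\<in>UNIV. \<Sum>j\<in>UNIV. overlap U V i j * (a i - b j)\<^sup>2)"
proof -
  have "(norm (eigmat U a - eigmat V b))\<^sup>2
      = (norm (eigmat U a))\<^sup>2 + (norm (eigmat V b))\<^sup>2 - 2 * (eigmat U a \<bullet> eigmat V b)"
    by (simp add: dot_square_norm[symmetric] inner_diff_left inner_diff_right inner_commute)
  also have "\<dots> = (\<Sum>i\<in>UNIV. \<Sum>j\<in>UNIV. overlap U V i j * (a i)\<^sup>2)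
      + (\<Sum>i\<in>UNIV. \<Sum>j\<in>UNIV. overlap U V i j * (b j)\<^sup>2)
      - 2 * (\<Sum>i\<in>UNIV. \<Sum>j\<in>UNIV. overlap U V i j * (a i * b j))"
    by (simp only: norm_eigmat assms overlap_sum_fst overlap_sum_snd inner_eigmat)
  also have "\<dots> = (\<Sum>i\<in>UNIV. \<Sum>j\<in>UNIV. overlap U V i j * (a i - b j)\<^sup>2)"
    by (simp add: power2_diff algebra_simps sum.distrib sum_subtractf sum_distrib_left)
  finally show ?thesis .
qed

subsection \<open>The exponential metric increasing property\<close>

text \<open>The right-hand side is the square of \<open>2 * sinh (r / 2)\<close>, so the claim for
  \<open>r \<ge> 0\<close> is the bound \<open>x \<le> sinh x\<close>; both sides are even in
  \<open>r\<close>.\<close>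

lemma square_le_exp:
  fixes r :: real
  shows "r\<^sup>2 \<le> exp r + exp (- r) - 2"
proof -
  have *: "r\<^sup>2 \<le> exp r + exp (- r) - 2" if "0 \<le> r" for r :: real
  proof -
    have "r / 2 \<le> (exp (r / 2) - inverse (exp (r / 2))) / 2"
      using that by (intro real_le_x_sinh) auto
    then have "r \<le> exp (r / 2) - exp (- (r / 2))"
      by (simp add: exp_minus)
    then have "r\<^sup>2 \<le> (exp (r / 2) - exp (- (r / 2)))\<^sup>2"
      using that by (intro power_mono) auto
    also have "\<dots> = exp r + exp (- r) - 2"
      by (simp add: power2_eq_square algebra_simps flip: exp_add)
    finally show ?thesis .
  qed
  show ?thesis using *[of r] *[of "- r"] by (cases "0 \<le> r") auto
qed

lemma ln_diff_square_le:
  fixes x y :: real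
  assumes "0 < x" "0 < y"
  shows "(ln x - ln y)\<^sup>2 \<le> x / y + y / x - 2"
  using square_le_exp[of "ln x - ln y"] assms by (simp add: exp_diff)

text \<open>A second-order upper bound for \<open>(ln x)\<^sup>2\<close> around \<open>y\<close> that is linear in \<open>x\<close> and \<open>1 / x\<close>, so that
  it sums over the spectra of two matrices to a combination of traces.\<close>

lemma ln_square_le:
  fixes x y :: real
  assumes "0 < x" "0 < y"
  shows "(ln x)\<^sup>2 \<le> (ln y)\<^sup>2 + 2 * ln y * (x / y - 1) + (1 + 2 * \<bar>ln y\<bar>) * (x / y + y / x - 2)"
proof -
  define r where "r = ln x - ln y"
  define v where "v = ln y"
  have e: "exp r = x / y" "exp (- r) = y / x"
    using assms by (simp_all add: r_def exp_diff)
  have r: "1 - exp (- r) \<le> r" "r \<le> exp r - 1"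
    using exp_ge_add_one_self[of "- r"] exp_ge_add_one_self[of r] by linarith+
  have s: "r\<^sup>2 \<le> exp r + exp (- r) - 2" by (rule square_le_exp)
  \<comment> \<open>The sign of \<open>v\<close> decides which of the two linear bounds on
    \<open>r\<close> applies. For negative \<open>v\<close> the lower bound
    \<open>1 - exp (- r)\<close> is used, and the last term is exactly what rewrites it in terms of
    \<open>exp r - 1\<close>.\<close>
  have "2 * v * r \<le> 2 * v * (exp r - 1) + 2 * \<bar>v\<bar> * (exp r + exp (- r) - 2)"
  proof (cases "0 \<le> v")
    case True
    have "0 \<le> v * (exp r + exp (- r) - 2)"
      using True s by (intro mult_nonneg_nonneg) (use zero_le_power2[of r] in linarith)+
    moreover have "v * r \<le> v * (exp r - 1)" using True r by (intro mult_left_mono)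
    ultimately show ?thesis using True by simp
  next
    case False
    then have "v * r \<le> v * (1 - exp (- r))" using r by (intro mult_left_mono_neg) auto
    then show ?thesis using False by (simp add: algebra_simps)
  qed
  with s have "(v + r)\<^sup>2 \<le> v\<^sup>2 + 2 * v * (exp r - 1) + (1 + 2 * \<bar>v\<bar>) * (exp r + exp (- r) - 2)"
    by (simp add: power2_sum algebra_simps)
  then show ?thesis by (simp add: e) (simp add: v_def r_def)
qed

text \<open>The scalar bound \<open>ln_diff_square_le\<close>, averaged over pairs of eigenvalues
  with the overlaps as weights. For nearby \<open>P\<close> and \<open>Q\<close> the right-hand side
  agrees with the squared natural distance to leading order, so it is sharp enough when applied to
  short pieces of a geodesic.\<close>

lemma norm_mat_log_diff_le:
  fixes P Q :: "real^'n^'n"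
  assumes "spd P" "spd Q"
  shows "(norm (mat_log P - mat_log Q))\<^sup>2
    \<le> trace (P ** matrix_inv Q) + trace (Q ** matrix_inv P) - 2 * real CARD('n)"
proof -
  obtain U p where U: "orthogonal_matrix U" and p: "\<And>i. 0 < p i" and P: "P = eigmat U p"
    using spd_eigmatE[OF assms(1)] by blast
  obtain V q where V: "orthogonal_matrix V" and q: "\<And>i. 0 < q i" and Q: "Q = eigmat V q"
    using spd_eigmatE[OF assms(2)] by blast
  have nz: "p i \<noteq> 0" "q i \<noteq> 0" for i using p[of i] q[of i] by auto
  have "(norm (mat_log P - mat_log Q))\<^sup>2
      = (\<Sum>i\<in>UNIV. \<Sum>j\<in>UNIV. overlap U V i j * (ln (p i) - ln (q j))\<^sup>2)"
    by (simp add: P Q mat_log_eigmat U V norm_eigmat_diff)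
  also have "\<dots> \<le> (\<Sum>i\<in>UNIV. \<Sum>j\<in>UNIV. overlap U V i j * (p i / q j + q j / p i - 2))"
    by (intro sum_mono mult_left_mono ln_diff_square_le p q overlap_nonneg)
  also have "\<dots> = (\<Sum>i\<in>UNIV. \<Sum>j\<in>UNIV. overlap U V i j * (p i * inverse (q j)))
      + (\<Sum>i\<in>UNIV. \<Sum>j\<in>UNIV. overlap U V i j * (inverse (p i) * q j))
      - (\<Sum>i\<in>UNIV. \<Sum>j\<in>UNIV. overlap U V i j * 2)"
    by (simp add: algebra_simps sum.distrib sum_subtractf divide_inverse)
  also have "\<dots> = trace (P ** matrix_inv Q) + trace (matrix_inv P ** Q) - 2 * real CARD('n)"
    by (simp add: P Q matrix_inv_eigmat U V nz trace_eigmat_mult overlap_sum_fst)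
  finally show ?thesis by (simp only: trace_mul_sym[of Q])
qed

section \<open>Geodesics and the passage from short pieces to the natural distance\<close>

lemma spd_whitened:
  assumes "spd A" "spd B"
  shows "spd (A mpowr s ** B ** A mpowr s)"
  using spd_congruence[OF assms(2) invertible_mpowr[OF assms(1)], of s]
  by (simp add: transpose_mpowr assms)

lemma spd_geodesic: "spd A \<Longrightarrow> spd B \<Longrightarrow> spd (geodesic A B t)"
  by (simp add: geodesic_def spd_whitened spd_mpowr)

lemma geodesic_0: "spd A \<Longrightarrow> spd B \<Longrightarrow> geodesic A B 0 = A"
  by (simp add: geodesic_def mpowr_0 spd_whitened mpowr_add mpowr_1)

lemma geodesic_1: "spd A \<Longrightarrow> spd B \<Longrightarrow> geodesic A B 1 = B"
  unfolding geodesic_def mpowr_1[OF spd_whitened]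
  by (simp add: matrix_mul_assoc[symmetric] mpowr_add_left mpowr_add mpowr_0)

lemma matrix_inv_geodesic:
  assumes "spd A" "spd B"
  shows "matrix_inv (geodesic A B t)
    = A mpowr (-1/2) ** (A mpowr (-1/2) ** B ** A mpowr (-1/2)) mpowr (- t) ** A mpowr (-1/2)"
proof (rule matrix_inv_eqI)
  define M where "M = A mpowr (-1/2) ** B ** A mpowr (-1/2)"
  have M: "spd M" using assms by (simp add: M_def spd_whitened)
  show "geodesic A B t ** (A mpowr (-1/2)
      ** (A mpowr (-1/2) ** B ** A mpowr (-1/2)) mpowr (- t) ** A mpowr (-1/2)) = mat 1"
    unfolding geodesic_def M_def[symmetric]
    by (simp add: matrix_mul_assoc[symmetric] mpowr_add_left mpowr_add mpowr_0 assms M)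
qed

text \<open>The outer powers of \<open>A\<close> cancel under the trace. Only the parameter
  difference survives, so equal pieces of a geodesic all receive the same bound.\<close>

lemma trace_geodesic_mult_inv:
  assumes "spd A" "spd B"
  shows "trace (geodesic A B t ** matrix_inv (geodesic A B s))
    = trace ((A mpowr (-1/2) ** B ** A mpowr (-1/2)) mpowr (t - s))"
proof -
  define M where "M = A mpowr (-1/2) ** B ** A mpowr (-1/2)"
  have M: "spd M" using assms by (simp add: M_def spd_whitened)
  have "geodesic A B t ** matrix_inv (geodesic A B s)
      = A mpowr (1/2) ** (M mpowr (t - s) ** A mpowr (-1/2))"
    unfolding matrix_inv_geodesic[OF assms] unfolding geodesic_def M_def[symmetric]
    by (simp add: matrix_mul_assoc[symmetric] mpowr_add_left mpowr_add mpowr_0 assms M)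
  then have "trace (geodesic A B t ** matrix_inv (geodesic A B s))
      = trace (M mpowr (t - s) ** A mpowr (-1/2) ** A mpowr (1/2))"
    by (simp only: trace_mul_sym[of "A mpowr (1/2)"])
  also have "\<dots> = trace (M mpowr (t - s))"
    by (simp add: matrix_mul_assoc[symmetric] mpowr_add mpowr_0 assms)
  finally show ?thesis by (simp add: M_def)
qed

text \<open>Cut the geodesic from \<open>A\<close> to \<open>B\<close> into \<open>m\<close> equal pieces
  and apply \<open>norm_mat_log_diff_le\<close> to each of them: only traces of powers of the
  whitened matrix remain, and \<open>m \<rightarrow> \<infinity>\<close> gives the natural distance.\<close>

lemma norm_mat_log_diff_le_natural_dist:
  fixes A B :: "real^'n^'n"
  assumes "spd A" "spd B"
  shows "norm (mat_log B - mat_log A) \<le> natural_dist A B"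
proof -
  define M where "M = A mpowr (-1/2) ** B ** A mpowr (-1/2)"
  have "spd M" using assms by (simp add: M_def spd_whitened)
  then obtain W \<mu> where W: "orthogonal_matrix W" and \<mu>: "\<And>i. 0 < \<mu> i" and M: "M = eigmat W \<mu>"
    by (rule spd_eigmatE) blast
  have nz: "\<mu> i \<noteq> 0" for i using \<mu>[of i] by simp
  \<comment> \<open>The value of the bound \<open>norm_mat_log_diff_le\<close> on one of
    \<open>m\<close> equal pieces, written in the eigenvalues of the whitened matrix.\<close>
  define c where "c m = (\<Sum>i\<in>UNIV. exp (ln (\<mu> i) / real m) + exp (- (ln (\<mu> i) / real m)) - 2)" for m
  have bound: "(norm (mat_log B - mat_log A))\<^sup>2 \<le> (real m)\<^sup>2 * c m" if "0 < m" for m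
  proof -
    define P where "P k = geodesic A B (real k / real m)" for k
    have tr: "trace (M mpowr s) = (\<Sum>i\<in>UNIV. exp (s * ln (\<mu> i)))" for s
      by (simp add: M mpowr_eigmat W trace_eigmat powr_def nz)
    have step: "norm (mat_log (P (Suc k)) - mat_log (P k)) \<le> sqrt (c m)" for k
    proof -
      have s: "real (Suc k) / real m - real k / real m = 1 / real m"
        "real k / real m - real (Suc k) / real m = - (1 / real m)"
        using that by (simp_all add: field_simps)
      have "(norm (mat_log (P (Suc k)) - mat_log (P k)))\<^sup>2
          \<le> trace (M mpowr (1 / real m)) + trace (M mpowr (- (1 / real m))) - 2 * real CARD('n)"
        using norm_mat_log_diff_le[of "P (Suc k)" "P k"]
        unfolding P_def trace_geodesic_mult_inv[OF assms] s M_def[symmetric]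
        by (simp only: spd_geodesic assms)
      also have "\<dots> = c m"
        unfolding tr c_def by (simp add: sum.distrib sum_subtractf)
      finally show ?thesis by (simp add: real_le_rsqrt)
    qed
    \<comment> \<open>The logarithms live in a normed space, so the triangle inequality adds up the
      bounds for the pieces.\<close>
    have "norm (mat_log (P k) - mat_log (P 0)) \<le> real k * sqrt (c m)" for k
    proof (induction k)
      case (Suc k)
      have "norm (mat_log (P (Suc k)) - mat_log (P 0))
          \<le> norm (mat_log (P (Suc k)) - mat_log (P k)) + norm (mat_log (P k) - mat_log (P 0))"
        using dist_triangle[of "mat_log (P (Suc k))" "mat_log (P 0)" "mat_log (P k)"]
        by (simp only: dist_norm)
      moreover have "real (Suc k) * sqrt (c m) = sqrt (c m) + real k * sqrt (c m)"
        by (simp add: distrib_right)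
      ultimately show ?case using step[of k] Suc by linarith
    qed simp
    from this[of m] have "norm (mat_log B - mat_log A) \<le> real m * sqrt (c m)"
      using that by (simp add: P_def geodesic_0 geodesic_1 assms)
    then have "(norm (mat_log B - mat_log A))\<^sup>2 \<le> (real m * sqrt (c m))\<^sup>2"
      by (intro power_mono) auto
    moreover have "0 \<le> c m"
    proof -
      have "0 \<le> exp x + exp (- x) - 2" for x :: real
        using square_le_exp[of x] zero_le_power2[of x] by linarith
      then show ?thesis unfolding c_def by (intro sum_nonneg)
    qed
    ultimately show ?thesis by (simp add: power_mult_distrib)
  qed
  \<comment> \<open>Second-order expansion of the exponentials: the error of the one-piece bound
    vanishes even after multiplication by the square of \<open>m\<close>.\<close>
  have lim: "(\<lambda>m::nat. (real m)\<^sup>2 * (exp (x / real m) + exp (- (x / real m)) - 2)) \<longlonglongrightarrow> x\<^sup>2" for x :: real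
    by (real_asymp simp add: power2_eq_square)
  have "(\<lambda>m. (real m)\<^sup>2 * c m) \<longlonglongrightarrow> (\<Sum>i\<in>UNIV. (ln (\<mu> i))\<^sup>2)"
    unfolding c_def sum_distrib_left by (intro tendsto_sum lim)
  moreover have "\<forall>\<^sub>F m in sequentially. (norm (mat_log B - mat_log A))\<^sup>2 \<le> (real m)\<^sup>2 * c m"
    using eventually_gt_at_top[of 0] by eventually_elim (rule bound)
  ultimately have "(norm (mat_log B - mat_log A))\<^sup>2 \<le> (\<Sum>i\<in>UNIV. (ln (\<mu> i))\<^sup>2)"
    by (intro tendsto_lowerbound) auto
  also have "\<dots> = (natural_dist A B)\<^sup>2"
    by (simp only: natural_dist_def M_def[symmetric]) (simp add: M mat_log_eigmat W norm_eigmat)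
  finally show ?thesis
    by (rule power2_le_imp_le) (simp add: natural_dist_def)
qed

subsection \<open>Invariance of the natural distance and its first variation\<close>

lemma norm_mat_log_orthogonal_conj:
  assumes "orthogonal_matrix Q" "spd X"
  shows "norm (mat_log (Q ** X ** transpose Q)) = norm (mat_log X)"
proof -
  obtain U d where U: "orthogonal_matrix U" and X: "X = eigmat U d"
    using spd_eigmatE[OF assms(2)] by blast
  have QU: "orthogonal_matrix (Q ** U)"
    using assms(1) U by (rule orthogonal_matrix_mul)
  have "(norm (mat_log (Q ** X ** transpose Q)))\<^sup>2 = (norm (mat_log X))\<^sup>2"
    by (simp add: X orthogonal_conj_eigmat mat_log_eigmat QU U norm_eigmat)
  then show ?thesis by simp
qed

text \<open>A congruence changes the whitened matrix \<open>X\<close> only into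
  \<open>Q ** X ** transpose Q\<close>, where \<open>Q\<close> is orthogonal, and this keeps the
  spectrum.\<close>

lemma natural_dist_congruence:
  fixes A B P :: "real^'n^'n"
  assumes "spd A" "spd B" "invertible P"
  shows "natural_dist (P ** A ** transpose P) (P ** B ** transpose P) = natural_dist A B"
proof -
  define A' where "A' = P ** A ** transpose P"
  have A': "spd A'" unfolding A'_def using assms(1,3) by (rule spd_congruence)
  define Q where "Q = A' mpowr (-1/2) ** P ** A mpowr (1/2)"
  define X where "X = A mpowr (-1/2) ** B ** A mpowr (-1/2)"
  have "Q ** transpose Q = A' mpowr (-1/2) ** P ** (A mpowr (1/2) ** A mpowr (1/2)) ** transpose P ** A' mpowr (-1/2)"
    by (simp add: Q_def matrix_transpose_mul transpose_mpowr A' assms matrix_mul_assoc)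
  also have "\<dots> = A' mpowr (-1/2) ** A' mpowr 1 ** A' mpowr (-1/2)"
    by (simp add: mpowr_add mpowr_1 assms A') (simp add: A'_def matrix_mul_assoc)
  finally have "Q ** transpose Q = mat 1"
    by (simp add: mpowr_add mpowr_0 A')
  then have Q: "orthogonal_matrix Q"
    by (simp add: orthogonal_matrix_def matrix_left_right_inverse)
  have "Q ** X ** transpose Q = A' mpowr (-1/2) ** P ** (A mpowr (1/2) ** A mpowr (-1/2)) ** B
      ** (A mpowr (-1/2) ** A mpowr (1/2)) ** transpose P ** A' mpowr (-1/2)"
    by (simp add: Q_def X_def matrix_transpose_mul transpose_mpowr A' assms matrix_mul_assoc)
  also have "\<dots> = A' mpowr (-1/2) ** (P ** B ** transpose P) ** A' mpowr (-1/2)"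
    by (simp add: mpowr_add mpowr_0 assms matrix_mul_assoc)
  finally have "natural_dist A' (P ** B ** transpose P) = norm (mat_log (Q ** X ** transpose Q))"
    by (simp add: natural_dist_def)
  also have "\<dots> = natural_dist A B"
    using Q assms by (simp add: norm_mat_log_orthogonal_conj X_def spd_whitened natural_dist_def)
  finally show ?thesis by (simp add: A'_def)
qed

lemma natural_dist_mat_1: "natural_dist (mat 1) X = norm (mat_log X)"
  by (simp add: natural_dist_def mat_1_mpowr)

text \<open>Whitening by \<open>A\<close> turns the pair into the identity and \<open>M\<close>.
  Exchanging these two replaces \<open>M\<close> by its inverse, whose logarithm differs only in
  sign.\<close>

lemma natural_dist_commute:
  assumes "spd A" "spd B"
  shows "natural_dist A B = natural_dist B A"
proof -
  define R where "R = A mpowr (-1/2)"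
  define M where "M = R ** B ** R"
  have R: "transpose R = R" "invertible R" "R ** A ** R = mat 1"
  proof -
    have "R ** A mpowr 1 ** R = mat 1"
      unfolding R_def by (simp only: mpowr_add[OF assms(1)]) (simp add: mpowr_0 assms)
    then show "R ** A ** R = mat 1" by (simp add: mpowr_1 assms)
  qed (simp_all add: R_def transpose_mpowr invertible_mpowr assms)
  have M: "spd M" unfolding M_def R_def using assms by (rule spd_whitened)
  have "natural_dist B A = natural_dist M (mat 1)"
    using natural_dist_congruence[OF assms(2,1) R(2)] by (simp add: R M_def)
  also have "\<dots> = norm (mat_log (M mpowr (-1)))"
    by (simp add: natural_dist_def mpowr_add M)
  also have "\<dots> = norm (mat_log M)" by (simp add: mat_log_mpowr M)
  finally show ?thesis by (simp add: natural_dist_def M_def R_def)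
qed

text \<open>The exponential metric increasing property bounds the distance below by that of the
  logarithms \<open>t *\<^sub>R mat_log M\<close> and \<open>s *\<^sub>R mat_log N\<close>, to which
  the Pythagorean theorem applies.\<close>

lemma natural_dist_mpowr_orthogonal_ge:
  assumes "spd M" "spd N" and orth: "mat_log M \<bullet> mat_log N = 0"
  shows "(t * norm (mat_log M))\<^sup>2 + (s * norm (mat_log N))\<^sup>2
    \<le> (natural_dist (M mpowr t) (N mpowr s))\<^sup>2"
proof -
  have "(norm (s *\<^sub>R mat_log N - t *\<^sub>R mat_log M))\<^sup>2 \<le> (natural_dist (M mpowr t) (N mpowr s))\<^sup>2"
    using norm_mat_log_diff_le_natural_dist[of "M mpowr t" "N mpowr s"]
    by (intro power_mono) (simp_all add: mat_log_mpowr spd_mpowr assms)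
  moreover have "(norm (s *\<^sub>R mat_log N - t *\<^sub>R mat_log M))\<^sup>2
      = (t * norm (mat_log M))\<^sup>2 + (s * norm (mat_log N))\<^sup>2"
    unfolding power_mult_distrib power2_norm_eq_inner
    using orth by (simp add: inner_diff_left inner_diff_right inner_commute[of "mat_log N" "mat_log M"]
        power2_eq_square)
  ultimately show ?thesis by simp
qed

lemma trace_conj_mult:
  fixes R M E :: "real^'n^'n"
  shows "trace (R ** M ** R ** E) = trace (M ** (R ** E ** R))"
proof -
  have "trace (R ** M ** R ** E) = trace (R ** (M ** R ** E))"
    by (simp add: matrix_mul_assoc)
  also have "\<dots> = trace (M ** R ** E ** R)"
    by (rule trace_mul_sym)
  finally show ?thesis by (simp add: matrix_mul_assoc)
qed

text \<open>Bounding \<open>d(N, M\<^sup>t)\<^sup>2\<close> from above by a function that agrees with it at \<open>t = 0\<close> and is visibly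
  differentiable avoids differentiating the matrix logarithm.\<close>

lemma natural_dist_mpowr_square_le:
  assumes M: "M = eigmat U m" "orthogonal_matrix U" "\<And>i. 0 < m i"
    and N: "N = eigmat V \<nu>" "orthogonal_matrix V" "\<And>i. 0 < \<nu> i"
  defines "s \<equiv> \<lambda>j. ln (\<nu> j)"
  defines "c \<equiv> \<lambda>j. 1 + 2 * \<bar>s j\<bar>"
  shows "(natural_dist N (M mpowr t))\<^sup>2 \<le> (\<Sum>j\<in>UNIV. (s j)\<^sup>2 + 2 * s j - 2 * c j)
    + (\<Sum>i\<in>UNIV. \<Sum>j\<in>UNIV. overlap U V i j
        * ((c j - 2 * s j) * exp (t * ln (m i)) + c j * exp (- (t * ln (m i)))))"
proof -
  have spdM: "spd M" and spdN: "spd N" using M N by (simp_all add: spd_eigmat)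
  have nz: "m i \<noteq> 0" "\<nu> i \<noteq> 0" for i using M(3)[of i] N(3)[of i] by auto
  define X where "X = N mpowr (-1/2) ** M mpowr t ** N mpowr (-1/2)"
  have "spd X" unfolding X_def by (intro spd_whitened spd_mpowr spdM spdN)
  then obtain W x where W: "orthogonal_matrix W" and x: "\<And>i. 0 < x i" and X: "X = eigmat W x"
    by (rule spd_eigmatE) blast
  have xnz: "x i \<noteq> 0" for i using x[of i] by simp
  have "(natural_dist N (M mpowr t))\<^sup>2 = (\<Sum>i\<in>UNIV. \<Sum>j\<in>UNIV. overlap W V i j * (ln (x i))\<^sup>2)"
    by (simp only: natural_dist_def X_def[symmetric] X mat_log_eigmat W norm_eigmat
        overlap_sum_fst[OF W N(2)])
  \<comment> \<open>At \<open>t = 0\<close> the matrix \<open>X\<close> is the inverse of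
    \<open>N\<close>, so \<open>ln_square_le\<close> is expanded at the reference point
    \<open>inverse (\<nu> j)\<close>. This is why the bound is exact there.\<close>
  also have "\<dots> \<le> (\<Sum>i\<in>UNIV. \<Sum>j\<in>UNIV. overlap W V i j * (((s j)\<^sup>2 + 2 * s j - 2 * c j)
      + x i * ((c j - 2 * s j) * \<nu> j) + inverse (x i) * (c j * inverse (\<nu> j))))"
  proof (intro sum_mono mult_left_mono overlap_nonneg)
    fix i j
    have "(ln (x i))\<^sup>2 \<le> (s j)\<^sup>2 - 2 * s j * (x i * \<nu> j - 1)
        + c j * (x i * \<nu> j + inverse (x i) * inverse (\<nu> j) - 2)"
      using ln_square_le[OF x, of "inverse (\<nu> j)" i] N(3)[of j]
      by (simp add: ln_inverse s_def c_def divide_inverse mult_ac)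
    then show "(ln (x i))\<^sup>2 \<le> ((s j)\<^sup>2 + 2 * s j - 2 * c j)
      + x i * ((c j - 2 * s j) * \<nu> j) + inverse (x i) * (c j * inverse (\<nu> j))"
      by (simp add: algebra_simps)
  qed
  also have "\<dots> = (\<Sum>j\<in>UNIV. (s j)\<^sup>2 + 2 * s j - 2 * c j)
      + trace (eigmat W x ** eigmat V (\<lambda>j. (c j - 2 * s j) * \<nu> j))
      + trace (eigmat W (\<lambda>i. inverse (x i)) ** eigmat V (\<lambda>j. c j * inverse (\<nu> j)))"
    by (simp only: distrib_left[where 'a = real] sum.distrib trace_eigmat_mult overlap_sum_snd[OF W N(2)])
  \<comment> \<open>Cycling the outer powers of \<open>N\<close> onto the second factor cancels
    \<open>\<nu> j\<close>; the unknown spectrum of \<open>X\<close> disappears in favour of powers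
    of \<open>M\<close>.\<close>
  also have "trace (eigmat W x ** eigmat V (\<lambda>j. (c j - 2 * s j) * \<nu> j))
      = trace (M mpowr t ** eigmat V (\<lambda>j. c j - 2 * s j))"
  proof -
    let ?E = "eigmat V (\<lambda>j. (c j - 2 * s j) * \<nu> j)"
    have "trace (X ** ?E) = trace (M mpowr t ** (N mpowr (-1/2) ** ?E ** N mpowr (-1/2)))"
      unfolding X_def by (rule trace_conj_mult)
    also have "N mpowr (-1/2) ** ?E ** N mpowr (-1/2)
        = eigmat V (\<lambda>j. (c j - 2 * s j) * (\<nu> j * (\<nu> j powr (-1/2) * \<nu> j powr (-1/2))))"
      by (simp add: N(1) mpowr_eigmat N(2) eigmat_mult mult_ac)
    also have "(\<lambda>j. (c j - 2 * s j) * (\<nu> j * (\<nu> j powr (-1/2) * \<nu> j powr (-1/2)))) = (\<lambda>j. c j - 2 * s j)"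
      using nz by (simp add: powr_add[symmetric] powr_minus_divide abs_of_pos[OF N(3)])
    finally show ?thesis by (simp only: X[symmetric])
  qed
  also have "trace (eigmat W (\<lambda>i. inverse (x i)) ** eigmat V (\<lambda>j. c j * inverse (\<nu> j)))
      = trace (M mpowr (- t) ** eigmat V c)"
  proof -
    let ?E = "eigmat V (\<lambda>j. c j * inverse (\<nu> j))"
    have "eigmat W (\<lambda>i. inverse (x i)) = matrix_inv X"
      by (simp add: X matrix_inv_eigmat W xnz)
    also have "matrix_inv X = N mpowr (1/2) ** M mpowr (- t) ** N mpowr (1/2)"
      by (rule matrix_inv_eqI)
        (simp add: X_def matrix_mul_assoc[symmetric] mpowr_add_left mpowr_add mpowr_0 spdM spdN)
    finally have "trace (eigmat W (\<lambda>i. inverse (x i)) ** ?E)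
        = trace (M mpowr (- t) ** (N mpowr (1/2) ** ?E ** N mpowr (1/2)))"
      by (simp only: trace_conj_mult)
    also have "N mpowr (1/2) ** ?E ** N mpowr (1/2)
        = eigmat V (\<lambda>j. c j * (inverse (\<nu> j) * (\<nu> j powr (1/2) * \<nu> j powr (1/2))))"
      by (simp add: N(1) mpowr_eigmat N(2) eigmat_mult mult_ac)
    also have "(\<lambda>j. c j * (inverse (\<nu> j) * (\<nu> j powr (1/2) * \<nu> j powr (1/2)))) = c"
      using N(3) nz by (simp add: powr_add[symmetric] less_imp_le)
    finally show ?thesis .
  qed
  finally show ?thesis
    by (simp add: M(1) mpowr_eigmat M(2) trace_eigmat_mult powr_def nz distrib_left sum.distrib mult_ac)
qed

text \<open>The upper bound \<open>K + G t\<close> touches the squared distance at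
  \<open>t = 0\<close>, so a minimum of the distance there is also a minimum of \<open>G\<close>.
  Hence the derivative of \<open>G\<close> at 0 vanishes.\<close>

lemma natural_dist_min_imp_orthogonal:
  assumes "spd M" "spd N"
    and min: "\<And>t. natural_dist (mat 1) N \<le> natural_dist (M mpowr t) N"
  shows "mat_log M \<bullet> mat_log N = 0"
proof -
  obtain U m where U: "orthogonal_matrix U" and m: "\<And>i. 0 < m i" and M: "M = eigmat U m"
    using spd_eigmatE[OF assms(1)] by blast
  obtain V \<nu> where V: "orthogonal_matrix V" and \<nu>: "\<And>i. 0 < \<nu> i" and N: "N = eigmat V \<nu>"
    using spd_eigmatE[OF assms(2)] by blast
  define s where "s j = ln (\<nu> j)" for j
  define c where "c j = 1 + 2 * \<bar>s j\<bar>" for j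
  define G where "G t = (\<Sum>i\<in>UNIV. \<Sum>j\<in>UNIV. overlap U V i j
        * ((c j - 2 * s j) * exp (t * ln (m i)) + c j * exp (- (t * ln (m i)))))" for t
  define K where "K = (\<Sum>j\<in>UNIV. (s j)\<^sup>2 + 2 * s j - 2 * c j)"
  have upper: "(natural_dist (M mpowr t) N)\<^sup>2 \<le> K + G t" for t
    using natural_dist_mpowr_square_le[OF M U m N V \<nu>, of t]
    by (simp only: natural_dist_commute[OF spd_mpowr[OF assms(1)] assms(2)] K_def G_def c_def s_def)
  have "(natural_dist (mat 1) N)\<^sup>2 = (\<Sum>j\<in>UNIV. (s j)\<^sup>2)"
    by (simp add: natural_dist_mat_1 N mat_log_eigmat V norm_eigmat s_def)
  also have "\<dots> = K + G 0"
  proof -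
    have "G 0 = (\<Sum>j\<in>UNIV. 2 * c j - 2 * s j)"
      unfolding G_def by (subst overlap_sum_snd[OF U V, symmetric]) simp
    then show ?thesis
      by (simp add: K_def sum.distrib sum_subtractf)
  qed
  finally have "G 0 \<le> G t" for t
    using upper[of t] power_mono[OF min[of t], of 2] by (simp add: natural_dist_def)
  moreover have "(G has_real_derivative (\<Sum>i\<in>UNIV. \<Sum>j\<in>UNIV. overlap U V i j
      * ((c j - 2 * s j) * ln (m i) + c j * (- ln (m i))))) (at 0)"
    unfolding G_def by (auto intro!: derivative_eq_intros sum.cong simp: mult_ac)
  ultimately have "(\<Sum>i\<in>UNIV. \<Sum>j\<in>UNIV. overlap U V i j
      * ((c j - 2 * s j) * ln (m i) + c j * (- ln (m i)))) = 0"
    by (intro DERIV_local_min[of G _ 0 1]) auto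
  \<comment> \<open>The terms with \<open>c\<close> are even in \<open>t\<close> and cancel in the
    derivative; what remains is the inner product of the logarithms.\<close>
  moreover have "(\<Sum>i\<in>UNIV. \<Sum>j\<in>UNIV. overlap U V i j
      * ((c j - 2 * s j) * ln (m i) + c j * (- ln (m i)))) = - 2 * (mat_log M \<bullet> mat_log N)"
    unfolding M N mat_log_eigmat[OF U] mat_log_eigmat[OF V] inner_eigmat s_def[symmetric] sum_distrib_left
    by (intro sum.cong) (auto simp: algebra_simps)
  ultimately show ?thesis by simp
qed

subsection \<open>Critical points of the divergence along a geodesic\<close>

text \<open>Up to the factor \<open>-1/2\<close>, the derivative in \<open>t\<close> of both Kullback--Leibler divergences along the
  geodesic has this form; \<open>l\<close> are the logarithmic eigenvalues of the whitened \<open>A\<^sub>2\<close>.\<close>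

definition kl_slope :: "('n::finite \<Rightarrow> real) \<Rightarrow> ('n \<Rightarrow> real) \<Rightarrow> real \<Rightarrow> real" where
  "kl_slope l a t = (\<Sum>i\<in>UNIV. l i * (a i * exp (- (t * l i)) - 1))"

text \<open>The derivative of the i-th summand is
  \<open>- (l i)\<^sup>2 * a i * exp (- (t * l i))\<close>, which is negative unless
  \<open>l i = 0\<close>.\<close>

lemma kl_slope_strict_antimono:
  assumes a: "\<And>i. 0 < a i" and l: "l k \<noteq> 0" and "s < t"
  shows "kl_slope l a t < kl_slope l a s"
proof -
  have strict: "l i * (a i * exp (- (t * l i)) - 1) < l i * (a i * exp (- (s * l i)) - 1)"
    if "l i \<noteq> 0" for i
  proof (cases "0 < l i")
    case True
    then show ?thesis using a[of i] \<open>s < t\<close> by simp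
  next
    case False
    then have "l i < 0" using that by simp
    then show ?thesis using a[of i] \<open>s < t\<close> by (simp add: mult_less_cancel_left)
  qed
  then have "l i * (a i * exp (- (t * l i)) - 1) \<le> l i * (a i * exp (- (s * l i)) - 1)" for i
    by (cases "l i = 0") (auto simp: less_imp_le)
  with strict[OF l] show ?thesis
    unfolding kl_slope_def by (intro sum_strict_mono_ex1) auto
qed

lemma kl_slope_inj:
  assumes "\<And>i. 0 < a i" "l k \<noteq> 0" "kl_slope l a s = kl_slope l a t"
  shows "s = t"
  using kl_slope_strict_antimono[of a l k s t] kl_slope_strict_antimono[of a l k t s] assms
  by (cases s t rule: linorder_cases) auto

lemma kl_slope_ex1_zero:
  fixes l a :: "'n::finite \<Rightarrow> real"
  assumes a: "\<And>i. 0 < a i" and l: "l k \<noteq> 0"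
  shows "\<exists>!t. kl_slope l a t = 0"
proof -
  \<comment> \<open>A summand with \<open>l i \<noteq> 0\<close> changes sign at
    \<open>ln (a i) / l i\<close>. The bound \<open>B\<close> exceeds the absolute value of all
    these points, so no summand is positive at \<open>B\<close> and none is negative at
    \<open>- B\<close>.\<close>
  define B where "B = 1 + (\<Sum>i\<in>UNIV. \<bar>ln (a i) / l i\<bar>)"
  have B: "\<bar>ln (a i) / l i\<bar> < B" for i
    using member_le_sum[of i UNIV "\<lambda>i. \<bar>ln (a i) / l i\<bar>"] by (simp add: B_def)
  have e: "a i * exp (- (t * l i)) = exp (- (l i * (t - ln (a i) / l i)))" if "l i \<noteq> 0" for i t
  proof -
    have "- (l i * (t - ln (a i) / l i)) = ln (a i) + - (t * l i)"
      using that by (simp add: field_simps)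
    then show ?thesis using a[of i] by (simp add: exp_diff exp_minus field_simps)
  qed
  have neg: "l i * (a i * exp (- (B * l i)) - 1) < 0" if "l i \<noteq> 0" for i
  proof -
    have "0 < B - ln (a i) / l i" using B[of i] by linarith
    then show ?thesis
      using that unfolding e[OF that]
      by (cases "0 < l i") (auto simp: mult_less_0_iff zero_less_mult_iff)
  qed
  have pos: "0 < l i * (a i * exp (- (- B * l i)) - 1)" if "l i \<noteq> 0" for i
  proof -
    have "- B - ln (a i) / l i < 0" using B[of i] by linarith
    then show ?thesis
      using that unfolding e[OF that]
      by (cases "0 < l i") (auto simp: mult_less_0_iff zero_less_mult_iff)
  qed
  have "kl_slope l a B < (\<Sum>i\<in>(UNIV::'n set). 0)"
    unfolding kl_slope_def by (rule sum_strict_mono_ex1) (use neg l less_eq_real_def in force)+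
  moreover have "(\<Sum>i\<in>(UNIV::'n set). 0) < kl_slope l a (- B)"
    unfolding kl_slope_def by (rule sum_strict_mono_ex1) (use pos l less_eq_real_def in force)+
  moreover have "continuous_on {- B..B} (kl_slope l a)"
    unfolding kl_slope_def by (intro continuous_intros)
  moreover have "- B \<le> B" using B[of undefined] by linarith
  ultimately obtain t where "kl_slope l a t = 0"
    using IVT2'[of "kl_slope l a" B 0 "- B"] by auto
  then show ?thesis using kl_slope_inj[of a l k, OF a l] by metis
qed

lemma is_arg_min_iff_kl_slope_eq_0:
  fixes l a :: "'n::finite \<Rightarrow> real"
  assumes a: "\<And>i. 0 < a i"
  shows "is_arg_min (\<lambda>t. ((\<Sum>i\<in>UNIV. a i * exp (- (t * l i))) + t * sum l UNIV + k) / 2) (\<lambda>_. True) t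
    \<longleftrightarrow> kl_slope l a t = 0" (is "is_arg_min ?f _ t \<longleftrightarrow> _")
proof
  assume "is_arg_min ?f (\<lambda>_. True) t"
  then have "?f t \<le> ?f u" for u by (auto simp: is_arg_min_def not_less)
  moreover have "(?f has_real_derivative - kl_slope l a t / 2) (at t)"
    unfolding kl_slope_def
    by (auto intro!: derivative_eq_intros
        simp: sum_negf[symmetric] sum.distrib[symmetric] algebra_simps)
  ultimately have "- kl_slope l a t / 2 = 0"
    by (intro DERIV_local_min[of ?f _ t 1]) auto
  then show "kl_slope l a t = 0" by simp
next
  assume 0: "kl_slope l a t = 0"
  have "?f t \<le> ?f u" for u
  proof -
    \<comment> \<open>Each summand is convex in the parameter and lies above its tangent line at
      \<open>t\<close>. Summed up, the tangent slopes give \<open>- kl_slope l a t\<close>, which is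
      0, so the critical point is a global minimum.\<close>
    have "a i * exp (- (t * l i)) + t * l i - (u - t) * (l i * (a i * exp (- (t * l i)) - 1))
        \<le> a i * exp (- (u * l i)) + u * l i" for i
    proof -
      have "1 + (t - u) * l i \<le> exp ((t - u) * l i)" by (rule exp_ge_add_one_self)
      then have "a i * exp (- (t * l i)) * (1 + (t - u) * l i)
          \<le> a i * exp (- (t * l i)) * exp ((t - u) * l i)"
        using a[of i] by (intro mult_left_mono) auto
      also have "\<dots> = a i * exp (- (u * l i))"
        by (simp add: algebra_simps flip: exp_add)
      finally show ?thesis by (simp add: algebra_simps)
    qed
    then have "(\<Sum>i\<in>UNIV. a i * exp (- (t * l i)) + t * l i
          - (u - t) * (l i * (a i * exp (- (t * l i)) - 1)))
        \<le> (\<Sum>i\<in>UNIV. a i * exp (- (u * l i)) + u * l i)"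
      by (intro sum_mono)
    then have "(\<Sum>i\<in>UNIV. a i * exp (- (t * l i))) + t * sum l UNIV - (u - t) * kl_slope l a t
        \<le> (\<Sum>i\<in>UNIV. a i * exp (- (u * l i))) + u * sum l UNIV"
      by (simp only: kl_slope_def sum_subtractf sum.distrib sum_distrib_left)
    then show ?thesis by (simp add: 0)
  qed
  then show "is_arg_min ?f (\<lambda>_. True) t" by (auto simp: is_arg_min_def not_less)
qed

text \<open>Implicit differentiation by squeezing: since \<open>kl_slope\<close> decreases in its last argument, its sign
  along the lines \<open>t = \<plusminus>\<eta> \<epsilon>\<close> traps the root between them.\<close>

lemma kl_slope_zero_has_derivative_0:
  fixes l :: "'n::finite \<Rightarrow> real" and a :: "real \<Rightarrow> 'n \<Rightarrow> real"
  assumes a: "\<And>\<epsilon> i. 0 < a \<epsilon> i" and l: "l k \<noteq> 0"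
    and a0: "\<And>i. a 0 i = 1"
    and a': "\<And>i. ((\<lambda>\<epsilon>. a \<epsilon> i) has_real_derivative a' i) (at 0)"
    and orth: "(\<Sum>i\<in>UNIV. l i * a' i) = 0"
    and \<tau>: "\<And>\<epsilon>. kl_slope l (a \<epsilon>) (\<tau> \<epsilon>) = 0"
  shows "(\<tau> has_real_derivative 0) (at 0)"
proof -
  have at0: "kl_slope l (a 0) 0 = 0" by (simp add: kl_slope_def a0)
  then have \<tau>0: "\<tau> 0 = 0" using kl_slope_inj[of "a 0" l k] a l \<tau>[of 0] by metis
  have pos: "0 < (\<Sum>i\<in>UNIV. (l i)\<^sup>2)"
    using l by (intro sum_pos2[of _ k]) auto
  \<comment> \<open>The contribution of \<open>a'\<close> drops out by \<open>orth\<close>, so to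
    first order only the tilt of the line matters.\<close>
  have der: "((\<lambda>\<epsilon>. kl_slope l (a \<epsilon>) (\<eta> * \<epsilon>)) has_real_derivative - \<eta> * (\<Sum>i\<in>UNIV. (l i)\<^sup>2)) (at 0)" for \<eta>
  proof -
    have "((\<lambda>\<epsilon>. kl_slope l (a \<epsilon>) (\<eta> * \<epsilon>)) has_real_derivative
        (\<Sum>i\<in>UNIV. l i * (a' i + - (\<eta> * l i)))) (at 0)"
      unfolding kl_slope_def by (auto intro!: derivative_eq_intros a' sum.cong simp: a0)
    moreover have "(\<Sum>i\<in>UNIV. l i * (a' i + - (\<eta> * l i))) = - \<eta> * (\<Sum>i\<in>UNIV. (l i)\<^sup>2)"
      using orth by (simp add: algebra_simps sum_subtractf sum_negf sum_distrib_left power2_eq_square)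
    ultimately show ?thesis by simp
  qed
  have below: "\<tau> \<epsilon> < u" if "kl_slope l (a \<epsilon>) u < 0" for \<epsilon> u
    using that kl_slope_strict_antimono[of "a \<epsilon>" l k u "\<tau> \<epsilon>"] a l \<tau>[of \<epsilon>]
    by (cases u "\<tau> \<epsilon>" rule: linorder_cases) auto
  have above: "u < \<tau> \<epsilon>" if "0 < kl_slope l (a \<epsilon>) u" for \<epsilon> u
    using that kl_slope_strict_antimono[of "a \<epsilon>" l k "\<tau> \<epsilon>" u] a l \<tau>[of \<epsilon>]
    by (cases u "\<tau> \<epsilon>" rule: linorder_cases) auto
  have bound: "\<exists>d>0. \<forall>h. \<bar>h\<bar> < d \<longrightarrow> \<bar>\<tau> h\<bar> \<le> \<eta> * \<bar>h\<bar>" if "0 < \<eta>" for \<eta>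
  proof -
    have neg: "- \<eta> * (\<Sum>i\<in>UNIV. (l i)\<^sup>2) < 0" and po: "0 < - (- \<eta>) * (\<Sum>i\<in>UNIV. (l i)\<^sup>2)"
      using that pos by (auto simp: mult_neg_pos)
    \<comment> \<open>The slope is 0 at the origin, with negative derivative along the line of tilt
      \<open>\<eta>\<close> and positive derivative along that of tilt \<open>- \<eta>\<close>. The
      four cases, two lines and two sides of 0, locate the root relative to each line.\<close>
    obtain d1 where d1: "0 < d1" "\<And>h. 0 < h \<Longrightarrow> h < d1 \<Longrightarrow> kl_slope l (a h) (\<eta> * h) < 0"
      using DERIV_neg_dec_right[OF der neg] by (auto simp: at0)
    obtain d2 where d2: "0 < d2" "\<And>h. 0 < h \<Longrightarrow> h < d2 \<Longrightarrow> 0 < kl_slope l (a (- h)) (\<eta> * - h)"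
      using DERIV_neg_dec_left[OF der neg] by (auto simp: at0)
    obtain d3 where d3: "0 < d3" "\<And>h. 0 < h \<Longrightarrow> h < d3 \<Longrightarrow> 0 < kl_slope l (a h) (- \<eta> * h)"
      using DERIV_pos_inc_right[OF der po] by (auto simp: at0)
    obtain d4 where d4: "0 < d4" "\<And>h. 0 < h \<Longrightarrow> h < d4 \<Longrightarrow> kl_slope l (a (- h)) (- \<eta> * - h) < 0"
      using DERIV_pos_inc_left[OF der po] by (auto simp: at0)
    have "\<bar>\<tau> h\<bar> \<le> \<eta> * \<bar>h\<bar>" if "\<bar>h\<bar> < Min {d1, d2, d3, d4}" for h
    proof (cases h "0 :: real" rule: linorder_cases)
      case equal
      then show ?thesis by (simp add: \<tau>0)
    next
      case greater
      then have "\<tau> h < \<eta> * h" "- \<eta> * h < \<tau> h"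
        using that d1(2)[of h, THEN below] d3(2)[of h, THEN above] by simp_all
      then show ?thesis using greater by (simp add: abs_le_iff)
    next
      case less
      then have "\<eta> * h < \<tau> h" "\<tau> h < - \<eta> * h"
        using that d2(2)[of "- h", THEN above] d4(2)[of "- h", THEN below] by simp_all
      then show ?thesis using less by (simp add: abs_le_iff)
    qed
    then show ?thesis using d1(1) d2(1) d3(1) d4(1) by (intro exI[of _ "Min {d1, d2, d3, d4}"]) auto
  qed
  have "(\<lambda>h. (\<tau> (0 + h) - \<tau> 0) / h) \<midarrow>0\<rightarrow> 0"
  proof (rule LIM_I)
    fix r :: real assume "0 < r"
    \<comment> \<open>Half of \<open>r\<close> leaves room for the strict inequality demanded by the
      limit.\<close>
    then obtain d where d: "0 < d" "\<And>h. \<bar>h\<bar> < d \<Longrightarrow> \<bar>\<tau> h\<bar> \<le> r / 2 * \<bar>h\<bar>"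
      using bound[of "r / 2"] by auto
    have "norm ((\<tau> (0 + h) - \<tau> 0) / h - 0) < r" if "h \<noteq> 0" "norm (h - 0) < d" for h
    proof -
      have "\<bar>\<tau> h\<bar> \<le> r / 2 * \<bar>h\<bar>" using d(2)[of h] that by simp
      also have "\<dots> < r * \<bar>h\<bar>" using \<open>0 < r\<close> that by simp
      finally show ?thesis using that by (simp add: \<tau>0 pos_divide_less_eq)
    qed
    with d(1) show "\<exists>s>0. \<forall>x. x \<noteq> 0 \<and> norm (x - 0) < s
        \<longrightarrow> norm ((\<tau> (0 + x) - \<tau> 0) / x - 0) < r" by blast
  qed
  then show ?thesis by (simp add: DERIV_def)
qed

subsection \<open>Reduction to the whitened matrices\<close>

lemma natural_dist_geodesic:
  assumes "spd A" "spd B" "spd C"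
  shows "natural_dist (geodesic A B s) (geodesic A C t)
    = natural_dist ((A mpowr (-1/2) ** B ** A mpowr (-1/2)) mpowr s)
        ((A mpowr (-1/2) ** C ** A mpowr (-1/2)) mpowr t)"
  using natural_dist_congruence[OF spd_mpowr[OF spd_whitened[OF assms(1,2)]]
      spd_mpowr[OF spd_whitened[OF assms(1,3)]] invertible_mpowr[OF assms(1), of "1/2"]]
  by (simp add: geodesic_def transpose_mpowr assms)

text \<open>The relative covariance is similar, through \<open>A mpowr (1/2)\<close>, to the product
  of the whitened powers, and the divergence depends only on its trace and determinant.\<close>

lemma KL_gauss_geodesic:
  fixes A B C :: "real^'n^'n"
  assumes "spd A" "spd B" "spd C"
  shows "KL_gauss (geodesic A B s) (geodesic A C t)
    = (trace ((A mpowr (-1/2) ** C ** A mpowr (-1/2)) mpowr (- t)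
          ** (A mpowr (-1/2) ** B ** A mpowr (-1/2)) mpowr s) - real CARD('n)
        - ln (det ((A mpowr (-1/2) ** C ** A mpowr (-1/2)) mpowr (- t))
            * det ((A mpowr (-1/2) ** B ** A mpowr (-1/2)) mpowr s))) / 2"
proof -
  define M where "M = A mpowr (-1/2) ** C ** A mpowr (-1/2)"
  define N where "N = A mpowr (-1/2) ** B ** A mpowr (-1/2)"
  define Z where "Z = M mpowr (- t) ** N mpowr s"
  have eq: "matrix_inv (geodesic A C t) ** geodesic A B s = A mpowr (-1/2) ** (Z ** A mpowr (1/2))"
    unfolding matrix_inv_geodesic[OF assms(1,3)]
    unfolding geodesic_def M_def[symmetric] N_def[symmetric] Z_def
    by (simp add: matrix_mul_assoc[symmetric] mpowr_add_left mpowr_0 assms)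
  have inv: "A mpowr (1/2) ** A mpowr (-1/2) = mat 1"
    by (simp add: mpowr_add mpowr_0 assms)
  have "trace (A mpowr (-1/2) ** (Z ** A mpowr (1/2))) = trace Z"
    by (simp only: trace_mul_sym[of "A mpowr (-1/2)"] matrix_mul_assoc[symmetric] inv matrix_mul_rid)
  moreover have "det (A mpowr (1/2)) * det (A mpowr (-1/2)) = 1"
    by (metis inv det_mul det_I)
  then have "det (A mpowr (-1/2) ** (Z ** A mpowr (1/2))) = det Z"
    by (simp add: det_mul mult_ac)
  ultimately show ?thesis
    by (simp only: KL_gauss_def eq) (simp add: Z_def M_def N_def det_mul)
qed

text \<open>Whitening is an isometry from the tangent space at \<open>A\<close> to symmetric
  matrices with the Frobenius inner product.\<close>

lemma natural_metric_log_map: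
  assumes "spd A" "spd B" "spd C"
  shows "natural_metric A (log_map A B) (log_map A C)
    = mat_log (A mpowr (-1/2) ** B ** A mpowr (-1/2)) \<bullet> mat_log (A mpowr (-1/2) ** C ** A mpowr (-1/2))"
proof -
  define S where "S = mat_log (A mpowr (-1/2) ** B ** A mpowr (-1/2))"
  define L where "L = mat_log (A mpowr (-1/2) ** C ** A mpowr (-1/2))"
  have eq: "log_map A B ** matrix_inv A ** log_map A C ** matrix_inv A
      = A mpowr (1/2) ** (S ** L ** A mpowr (-1/2))"
    unfolding log_map_def S_def[symmetric] L_def[symmetric] matrix_inv_spd[OF assms(1)]
    by (simp add: matrix_mul_assoc[symmetric] mpowr_add_left mpowr_add mpowr_0 assms)
  have inv: "A mpowr (-1/2) ** A mpowr (1/2) = mat 1"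
    by (simp add: mpowr_add mpowr_0 assms)
  have "trace (A mpowr (1/2) ** (S ** L ** A mpowr (-1/2))) = trace (S ** L)"
    by (simp only: trace_mul_sym[of "A mpowr (1/2)"] matrix_mul_assoc[symmetric] inv matrix_mul_rid)
  moreover have "transpose L = L"
    unfolding L_def by (intro transpose_mat_log spd_whitened assms)
  ultimately show ?thesis
    using trace_mult_transpose[of S L] by (simp add: natural_metric_def eq S_def L_def)
qed

lemma trace_mult_diag: "trace ((X - mat 1) ** diag d) = (\<Sum>i\<in>UNIV. d i * (X $ i $ i - 1))"
  by (simp add: trace_def mult_diagonal_nth mat_def mult.commute)

lemma powr_eq_exp_ln: "0 < x \<Longrightarrow> x powr t = exp (t * ln (x :: real))"
  by (simp add: powr_def)

lemma ln_prod_powr: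
  fixes d :: "'n::finite \<Rightarrow> real"
  assumes "\<And>i. 0 < d i"
  shows "ln (\<Prod>i\<in>UNIV. d i powr t) = t * (\<Sum>i\<in>UNIV. ln (d i))"
  using assms by (subst ln_prod) (auto simp: less_imp_neq[symmetric] sum_distrib_left)

section \<open>The two divergence projections in the eigenbasis of the whitened second
  endpoint\<close>

locale geodesic_pair =
  fixes A1 A2 C U V :: "real^'n^'n" and \<mu> \<sigma> :: "'n \<Rightarrow> real"
  assumes spd: "spd A1" "spd A2" "spd C" and neq: "A1 \<noteq> A2"
    and U: "orthogonal_matrix U" and M: "A1 mpowr (-1/2) ** A2 ** A1 mpowr (-1/2) = eigmat U \<mu>"
    and V: "orthogonal_matrix V" and N: "A1 mpowr (-1/2) ** C ** A1 mpowr (-1/2) = eigmat V \<sigma>"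
begin

text \<open>The i-th diagonal entry of the \<open>\<epsilon>\<close>-th power of the whitened
  \<open>C\<close>, expressed in the eigenbasis \<open>U\<close>.\<close>

definition coef :: "real \<Rightarrow> 'n \<Rightarrow> real" where
  "coef \<epsilon> i = (\<Sum>j\<in>UNIV. overlap U V i j * \<sigma> j powr \<epsilon>)"

abbreviation l :: "'n \<Rightarrow> real" where "l i \<equiv> ln (\<mu> i)"

lemma spd_M: "spd (eigmat U \<mu>)" and spd_N: "spd (eigmat V \<sigma>)"
  using spd_whitened[OF spd(1,2)] spd_whitened[OF spd(1,3)] by (simp_all flip: M N)

lemma pos: "0 < \<mu> i" "0 < \<sigma> i"
  using spd_eigmat_pos spd_M spd_N U V by blast+

lemma nz: "\<mu> i \<noteq> 0" "\<sigma> i \<noteq> 0"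
  using pos[of i] by auto

lemma coef_pos: "0 < coef \<epsilon> i"
proof -
  have "\<exists>j. overlap U V i j \<noteq> 0"
    using overlap_sum_right[OF U V, of i] by (metis sum.neutral zero_neq_one)
  then obtain j where "0 < overlap U V i j"
    using overlap_nonneg by (metis less_eq_real_def)
  then show ?thesis
    unfolding coef_def using nz overlap_nonneg[of U V i]
    by (intro sum_pos2[of _ j]) (auto intro!: mult_nonneg_nonneg)
qed

lemma coef_0: "coef 0 i = 1"
  using overlap_sum_right[OF U V, of i] by (simp add: coef_def nz)

lemma coef_has_derivative:
  "((\<lambda>\<epsilon>. coef \<epsilon> i) has_real_derivative (\<Sum>j\<in>UNIV. overlap U V i j * ln (\<sigma> j))) (at 0)"
  unfolding coef_def powr_eq_exp_ln[OF pos(2)] by (auto intro!: derivative_eq_intros sum.cong)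

text \<open>If all logarithmic eigenvalues vanished, the whitened \<open>A2\<close> would be the
  identity and the two endpoints would coincide. The index found here is what makes the slopes
  strictly decreasing.\<close>

lemma ex_log_nonzero: "\<exists>k. l k \<noteq> 0"
proof (rule ccontr)
  assume "\<not> ?thesis"
  then have "\<mu> = (\<lambda>_. 1)" using pos by auto
  then have "A1 mpowr (-1/2) ** A2 ** A1 mpowr (-1/2) = mat 1"
    using eigmat_1[OF U] M by simp
  then have "geodesic A1 A2 1 = A1"
    unfolding geodesic_def by (simp add: mat_1_mpowr mpowr_add mpowr_1 spd)
  then show False using neq by (simp add: geodesic_1 spd)
qed

lemma KL_reverse_I_projection:
  "KL_gauss (geodesic A1 C \<epsilon>) (geodesic A1 A2 t)
    = ((\<Sum>i\<in>UNIV. coef \<epsilon> i * exp (- (t * l i))) + t * sum l UNIV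
        + (- real CARD('n) - \<epsilon> * (\<Sum>j\<in>UNIV. ln (\<sigma> j)))) / 2"
proof -
  have "trace (eigmat U \<mu> mpowr (- t) ** eigmat V \<sigma> mpowr \<epsilon>) = (\<Sum>i\<in>UNIV. coef \<epsilon> i * exp (- (t * l i)))"
    by (simp add: mpowr_eigmat U V trace_eigmat_mult coef_def powr_eq_exp_ln[OF pos(1)]
        sum_distrib_left sum_distrib_right mult_ac)
  moreover have "0 < (\<Prod>i\<in>UNIV. \<mu> i powr - t)" "0 < (\<Prod>i\<in>UNIV. \<sigma> i powr \<epsilon>)"
    by (auto intro!: prod_pos simp: nz)
  ultimately show ?thesis
    unfolding KL_gauss_geodesic[OF spd(1,3,2)] M N
    by (simp add: mpowr_eigmat U V det_eigmat ln_mult ln_prod_powr pos nz)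
qed

text \<open>Exchanging the arguments of the divergence inverts both whitened powers. The same normal
  form returns with \<open>- l\<close> and \<open>- \<epsilon>\<close>, so one analysis of critical
  points serves both projections.\<close>

lemma KL_I_projection:
  "KL_gauss (geodesic A1 A2 t) (geodesic A1 C \<epsilon>)
    = ((\<Sum>i\<in>UNIV. coef (- \<epsilon>) i * exp (- (t * - l i))) + t * (\<Sum>i\<in>UNIV. - l i)
        + (- real CARD('n) + \<epsilon> * (\<Sum>j\<in>UNIV. ln (\<sigma> j)))) / 2"
proof -
  have "trace (eigmat V \<sigma> mpowr (- \<epsilon>) ** eigmat U \<mu> mpowr t)
      = (\<Sum>i\<in>UNIV. coef (- \<epsilon>) i * exp (- (t * - l i)))"
    by (subst trace_mul_sym)
      (simp add: mpowr_eigmat U V trace_eigmat_mult coef_def powr_eq_exp_ln[OF pos(1)]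
        sum_distrib_left sum_distrib_right mult_ac)
  moreover have "0 < (\<Prod>i\<in>UNIV. \<sigma> i powr - \<epsilon>)" "0 < (\<Prod>i\<in>UNIV. \<mu> i powr t)"
    by (auto intro!: prod_pos simp: nz)
  ultimately show ?thesis
    unfolding KL_gauss_geodesic[OF spd(1,2,3)] M N
    by (simp add: mpowr_eigmat U V det_eigmat ln_mult ln_prod_powr pos nz sum_negf)
qed

lemma is_reverse_I_projection_iff:
  "is_reverse_I_projection A1 A2 (geodesic A1 C \<epsilon>) t \<longleftrightarrow> kl_slope l (coef \<epsilon>) t = 0"
  unfolding is_reverse_I_projection_def KL_reverse_I_projection
  by (rule is_arg_min_iff_kl_slope_eq_0) (rule coef_pos)

lemma is_I_projection_iff:
  "is_I_projection A1 A2 (geodesic A1 C \<epsilon>) t \<longleftrightarrow> kl_slope (\<lambda>i. - l i) (coef (- \<epsilon>)) t = 0"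
  unfolding is_I_projection_def KL_I_projection
  by (rule is_arg_min_iff_kl_slope_eq_0) (rule coef_pos)

lemma reverse_I_projection_ex1: "\<exists>!t. is_reverse_I_projection A1 A2 (geodesic A1 C \<epsilon>) t"
proof -
  obtain k where "l k \<noteq> 0" using ex_log_nonzero by blast
  then show ?thesis
    unfolding is_reverse_I_projection_iff by (intro kl_slope_ex1_zero coef_pos)
qed

lemma I_projection_ex1: "\<exists>!t. is_I_projection A1 A2 (geodesic A1 C \<epsilon>) t"
proof -
  obtain k where "- l k \<noteq> 0" using ex_log_nonzero by auto
  then show ?thesis
    unfolding is_I_projection_iff by (intro kl_slope_ex1_zero coef_pos)
qed

lemma kl_slope_eq_0_iff_reverse_I_projection:
  "kl_slope l (coef \<epsilon>) t = 0 \<longleftrightarrow> t = reverse_I_projection A1 A2 (geodesic A1 C \<epsilon>)"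
  unfolding reverse_I_projection_def is_reverse_I_projection_iff[symmetric]
  using reverse_I_projection_ex1[of \<epsilon>] by (metis the1_equality)

lemma kl_slope_eq_0_iff_I_projection:
  "kl_slope (\<lambda>i. - l i) (coef (- \<epsilon>)) t = 0 \<longleftrightarrow> t = I_projection A1 A2 (geodesic A1 C \<epsilon>)"
  unfolding I_projection_def is_I_projection_iff[symmetric]
  using I_projection_ex1[of \<epsilon>] by (metis the1_equality)

text \<open>The power of \<open>diag \<mu>\<close> contributes \<open>exp (\<delta> * l i)\<close>,
  whereas \<open>kl_slope\<close> decays in its argument. Hence the argument
  \<open>- \<delta>\<close>: roots of the trace equation are the negatives of the projection
  parameters.\<close>

lemma trace_reverse_I_projection_eq:
  "trace ((transpose U ** V ** diag \<sigma> mpowr \<epsilon> ** transpose V ** U ** diag \<mu> mpowr \<delta> - mat 1)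
      ** mat_log (diag \<mu>)) = kl_slope l (coef \<epsilon>) (- \<delta>)"
proof -
  have I: "orthogonal_matrix (mat 1 :: real^'n^'n)" by (rule orthogonal_matrix_id)
  have "transpose U ** V ** diag \<sigma> mpowr \<epsilon> ** transpose V ** U
      = transpose U ** eigmat V (\<lambda>j. \<sigma> j powr \<epsilon>) ** U"
    using mpowr_eigmat[OF I, of \<sigma> \<epsilon>] by (simp add: eigmat_mat_1 eigmat_def[of V] matrix_mul_assoc)
  then show ?thesis
    using mpowr_eigmat[OF I, of \<mu> \<delta>] mat_log_eigmat[OF I, of \<mu>]
    by (simp add: eigmat_mat_1 trace_mult_diag mult_diagonal_nth transpose_conj_eigmat_nth
        coef_def[symmetric] kl_slope_def powr_eq_exp_ln[OF pos(1)])
qed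

lemma trace_I_projection_eq:
  "trace ((diag \<mu> mpowr (- \<delta>) ** transpose U ** V ** diag \<sigma> mpowr (- \<epsilon>) ** transpose V ** U - mat 1)
      ** mat_log (diag \<mu>)) = - kl_slope (\<lambda>i. - l i) (coef (- \<epsilon>)) (- \<delta>)"
proof -
  have I: "orthogonal_matrix (mat 1 :: real^'n^'n)" by (rule orthogonal_matrix_id)
  have "diag \<mu> mpowr (- \<delta>) ** transpose U ** V ** diag \<sigma> mpowr (- \<epsilon>) ** transpose V ** U
      = diag (\<lambda>i. \<mu> i powr (- \<delta>)) ** (transpose U ** eigmat V (\<lambda>j. \<sigma> j powr (- \<epsilon>)) ** U)"
    using mpowr_eigmat[OF I, of \<sigma> "- \<epsilon>"] mpowr_eigmat[OF I, of \<mu> "- \<delta>"]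
    by (simp add: eigmat_mat_1 eigmat_def[of V] matrix_mul_assoc)
  then show ?thesis
    using mat_log_eigmat[OF I, of \<mu>]
    by (simp add: eigmat_mat_1 trace_mult_diag diagonal_mult_nth transpose_conj_eigmat_nth
        coef_def[symmetric] kl_slope_def powr_eq_exp_ln[OF pos(1)] sum_negf[symmetric] mult_ac)
qed

end

section \<open>Consequences of the minimality of the distance at the first endpoint\<close>

locale orthogonal_geodesic_pair = geodesic_pair +
  assumes min: "is_natural_projection A1 A2 C 0"
begin

lemma inner_log_eq_0: "mat_log (eigmat U \<mu>) \<bullet> mat_log (eigmat V \<sigma>) = 0"
proof (rule natural_dist_min_imp_orthogonal[OF spd_M spd_N])
  fix t
  have "natural_dist (geodesic A1 A2 0) (geodesic A1 C 1) \<le> natural_dist (geodesic A1 A2 t) (geodesic A1 C 1)"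
    using min by (auto simp: is_natural_projection_def is_arg_min_def not_less geodesic_1 spd)
  then show "natural_dist (mat 1) (eigmat V \<sigma>) \<le> natural_dist (eigmat U \<mu> mpowr t) (eigmat V \<sigma>)"
    by (simp only: natural_dist_geodesic spd M N mpowr_0 spd_M mpowr_1 spd_N)
qed

lemma natural_dist_at_0:
  "natural_dist (geodesic A1 A2 0) (geodesic A1 C \<epsilon>) = \<bar>\<epsilon>\<bar> * norm (mat_log (eigmat V \<sigma>))"
  by (simp only: natural_dist_geodesic spd M N mpowr_0 spd_M natural_dist_mat_1 mat_log_mpowr spd_N
      norm_scaleR)

lemma norm_log_pos: "0 < norm (mat_log (eigmat U \<mu>))"
proof -
  obtain k where "l k \<noteq> 0" using ex_log_nonzero by blast
  then have "0 < (\<Sum>i\<in>UNIV. (l i)\<^sup>2)"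
    by (intro sum_pos2[of _ k]) auto
  also have "\<dots> = (norm (mat_log (eigmat U \<mu>)))\<^sup>2"
    by (simp only: mat_log_eigmat U norm_eigmat)
  finally show ?thesis by auto
qed

text \<open>Minimality is given only for \<open>C\<close>, but the orthogonality that it yields
  concerns the logarithms and is unaffected by scaling one of them by
  \<open>\<epsilon>\<close>.\<close>

lemma is_natural_projection_iff: "is_natural_projection A1 A2 (geodesic A1 C \<epsilon>) t \<longleftrightarrow> t = 0"
proof -
  have lt: "natural_dist (geodesic A1 A2 0) (geodesic A1 C \<epsilon>)
      < natural_dist (geodesic A1 A2 t) (geodesic A1 C \<epsilon>)" if "t \<noteq> 0" for t
  proof -
    have "0 < (t * norm (mat_log (eigmat U \<mu>)))\<^sup>2"
      using that norm_log_pos by simp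
    moreover have "(t * norm (mat_log (eigmat U \<mu>)))\<^sup>2 + (\<epsilon> * norm (mat_log (eigmat V \<sigma>)))\<^sup>2
        \<le> (natural_dist (geodesic A1 A2 t) (geodesic A1 C \<epsilon>))\<^sup>2"
      using natural_dist_mpowr_orthogonal_ge[OF spd_M spd_N inner_log_eq_0]
      by (simp only: natural_dist_geodesic spd M N)
    ultimately have "(natural_dist (geodesic A1 A2 0) (geodesic A1 C \<epsilon>))\<^sup>2
        < (natural_dist (geodesic A1 A2 t) (geodesic A1 C \<epsilon>))\<^sup>2"
      by (simp add: natural_dist_at_0 power_mult_distrib)
    then show ?thesis
      by (rule power2_less_imp_less) (simp add: natural_dist_def)
  qed
  show ?thesis
    unfolding is_natural_projection_def is_arg_min_def using lt by (metis less_asym)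
qed

lemma natural_projection_eq_0: "natural_projection A1 A2 (geodesic A1 C \<epsilon>) = 0"
  by (simp add: natural_projection_def is_natural_projection_iff)

text \<open>The sum is the inner product of the two whitened logarithms written with overlaps. It is
  the numerator of the implicit derivative of the critical point.\<close>

lemma coef_derivative_orthogonal: "(\<Sum>i\<in>UNIV. l i * (\<Sum>j\<in>UNIV. overlap U V i j * ln (\<sigma> j))) = 0"
  using inner_log_eq_0 by (simp add: mat_log_eigmat U V inner_eigmat sum_distrib_left mult_ac)

lemma reverse_I_diff_eq: "reverse_I_diff A1 A2 C \<epsilon> = reverse_I_projection A1 A2 (geodesic A1 C \<epsilon>)"
  by (simp add: reverse_I_diff_def natural_projection_eq_0)

lemma I_diff_eq: "I_diff A1 A2 C \<epsilon> = I_projection A1 A2 (geodesic A1 C \<epsilon>)"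
  by (simp add: I_diff_def natural_projection_eq_0)

lemma reverse_I_diff_has_derivative_0: "(reverse_I_diff A1 A2 C has_real_derivative 0) (at 0)"
proof -
  obtain k where "l k \<noteq> 0" using ex_log_nonzero by blast
  then show ?thesis
    by (rule kl_slope_zero_has_derivative_0[OF coef_pos _ coef_0 coef_has_derivative
          coef_derivative_orthogonal])
      (simp add: reverse_I_diff_eq kl_slope_eq_0_iff_reverse_I_projection)
qed

text \<open>Passing to \<open>- l\<close> and to \<open>- \<epsilon>\<close> flips two signs, which
  cancel in the orthogonality condition.\<close>

lemma I_diff_has_derivative_0: "(I_diff A1 A2 C has_real_derivative 0) (at 0)"
proof -
  obtain k where k: "- l k \<noteq> 0" using ex_log_nonzero by auto
  have "((\<lambda>\<epsilon>. coef (- \<epsilon>) i) has_real_derivative - (\<Sum>j\<in>UNIV. overlap U V i j * ln (\<sigma> j))) (at 0)" for i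
    using coef_has_derivative[of i] DERIV_mirror[where f = "\<lambda>\<epsilon>. coef \<epsilon> i" and x = 0] by simp
  then show ?thesis
  proof (rule kl_slope_zero_has_derivative_0[of "\<lambda>\<epsilon>. coef (- \<epsilon>)" "\<lambda>i. - l i" k, OF coef_pos k, rotated])
    show "(\<Sum>i\<in>UNIV. - l i * - (\<Sum>j\<in>UNIV. overlap U V i j * ln (\<sigma> j))) = 0"
      using coef_derivative_orthogonal by simp
    show "kl_slope (\<lambda>i. - l i) (coef (- \<epsilon>)) (I_diff A1 A2 C \<epsilon>) = 0" for \<epsilon>
      by (simp add: I_diff_eq kl_slope_eq_0_iff_I_projection)
  qed (simp add: coef_0)
qed

end

theorem theorem4p2:
  fixes A1 A2 C U V \<Lambda> \<Sigma> :: "real^'n^'n"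
  assumes "spd A1" and "spd A2" and "spd C" and "A1 \<noteq> A2"
    and "is_natural_projection A1 A2 C 0"
    and "orthogonal_eigendecomposition (A1 mpowr (-1/2) ** C ** A1 mpowr (-1/2)) V \<Sigma>"
    and "orthogonal_eigendecomposition (A1 mpowr (-1/2) ** A2 ** A1 mpowr (-1/2)) U \<Lambda>"
  shows
    "(\<forall>\<epsilon>. (\<exists>!t. is_natural_projection A1 A2 (geodesic A1 C \<epsilon>) t)
        \<and> (\<exists>!t. is_reverse_I_projection A1 A2 (geodesic A1 C \<epsilon>) t)
        \<and> (\<exists>!t. is_I_projection A1 A2 (geodesic A1 C \<epsilon>) t))
     \<and> (\<forall>\<epsilon>. natural_dist
               (geodesic A1 A2 (natural_projection A1 A2 (geodesic A1 C \<epsilon>))) (geodesic A1 C \<epsilon>)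
             = \<bar>\<epsilon>\<bar> * natural_dist A1 C)
     \<and> (\<forall>\<epsilon> \<delta>. trace ((transpose U ** V ** \<Sigma> mpowr \<epsilon> ** transpose V ** U ** \<Lambda> mpowr \<delta> - mat 1)
                       ** mat_log \<Lambda>) = 0
               \<longleftrightarrow> \<delta> = - reverse_I_diff A1 A2 C \<epsilon>)
     \<and> (\<forall>\<epsilon> \<delta>. trace ((\<Lambda> mpowr (- \<delta>) ** transpose U ** V ** \<Sigma> mpowr (- \<epsilon>) ** transpose V ** U - mat 1)
                       ** mat_log \<Lambda>) = 0
               \<longleftrightarrow> \<delta> = - I_diff A1 A2 C \<epsilon>)
     \<and> isCont (reverse_I_diff A1 A2 C) 0
     \<and> isCont (I_diff A1 A2 C) 0
     \<and> (reverse_I_diff A1 A2 C has_real_derivative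
          - natural_metric A1 (log_map A1 C) (log_map A1 A2) / natural_dist A1 A2) (at 0)
     \<and> (I_diff A1 A2 C has_real_derivative
          - natural_metric A1 (log_map A1 C) (log_map A1 A2) / natural_dist A1 A2) (at 0)
     \<and> - natural_metric A1 (log_map A1 C) (log_map A1 A2) / natural_dist A1 A2 = 0"
proof -
  obtain \<sigma> where V: "orthogonal_matrix V" and \<Sigma>: "\<Sigma> = diag \<sigma>"
    and N: "A1 mpowr (-1/2) ** C ** A1 mpowr (-1/2) = eigmat V \<sigma>"
    using assms(6) by (rule orthogonal_eigendecompositionE)
  obtain \<mu> where U: "orthogonal_matrix U" and \<Lambda>: "\<Lambda> = diag \<mu>"
    and M: "A1 mpowr (-1/2) ** A2 ** A1 mpowr (-1/2) = eigmat U \<mu>"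
    using assms(7) by (rule orthogonal_eigendecompositionE)
  interpret orthogonal_geodesic_pair A1 A2 C U V \<mu> \<sigma>
    by unfold_locales (fact assms U V M N)+
  \<comment> \<open>This identifies the derivative 0 with the claimed quotient: its numerator is the
    inner product of the whitened logarithms.\<close>
  have metric: "natural_metric A1 (log_map A1 C) (log_map A1 A2) = 0"
    using inner_log_eq_0
    by (simp only: natural_metric_log_map assms M N) (simp add: inner_commute)
  have dist: "natural_dist A1 C = norm (mat_log (eigmat V \<sigma>))"
    by (simp only: natural_dist_def N)
  have "- \<delta> = t \<longleftrightarrow> \<delta> = - t" for \<delta> t :: real by auto
  then show ?thesis
    using is_natural_projection_iff reverse_I_projection_ex1 I_projection_ex1
      reverse_I_diff_has_derivative_0 I_diff_has_derivative_0
      DERIV_isCont[OF reverse_I_diff_has_derivative_0] DERIV_isCont[OF I_diff_has_derivative_0]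
    by (simp add: metric \<Sigma> \<Lambda> trace_reverse_I_projection_eq trace_I_projection_eq reverse_I_diff_eq I_diff_eq
        kl_slope_eq_0_iff_reverse_I_projection kl_slope_eq_0_iff_I_projection
        natural_projection_eq_0 natural_dist_at_0 dist)
qed

end
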